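(* Let $k$ and $K$ be the fields constructed in the context. Then the extension $K/k$ is $lq$-finite and its degree of irrationality $di(K/k)$ is infinite.
   Context: Let $Q$ be a perfect field of characteristic $p>0$, let $X,(Y_i,Z_i)_{i\ge1}$ be algebraically independent over $Q$ and $k=Q(X,(Y_i,Z_i)_{i\ge1})$ the field of rational functions. All $p$-power roots are taken in a fixed algebraic closure of $k$. For $n\ge2$ and $1\le j\le n-1$ put $$\alpha_j^n=Z_j^{p^{-n+j}}X^{p^{-n}}+Y_j^{p^{-n+j}}$$ (the $n$ in $\alpha_j^n$ is an upper index), $K_n=k(X^{p^{-n}},\alpha_1^n,\dots,\alpha_{n-1}^n)$, and $K=\bigcup_{n\ge2}K_n$ (an increasing union), a purely inseparable extension of $k$. For a purely inseparable extension $K/k$ and $n\ge1$ put $k_n=\{x\in K:x^{p^n}\in k\}$. $K/k$ is $lq$-finite if $k_n/k$ is finite for every $n\ge1$. A subset $B\subseteq K$ is an $r$-base of $K/k$ if $K=k(K^p)(B)$ and, for every $x\in B$, $x\notin k(K^p)(B\setminus\{x\})$; all $r$-bases of an extension have the same cardinality. The degree of irrationality is the cardinal $di(K/k)=\sup_{n\ge1}|B_n|$, where $B_n$ is an $r$-base of $k_n/k$. *)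

theory Defs
  imports
    "HOL-Algebra.Algebraic_Closure_Type"
    "HOL-Algebra.Generated_Fields"
    "HOL-Library.Poly_Mapping"
begin

unbundle cardinal_syntax

text \<open>All fields live in one ambient field, the type \<open>'a\<close>; its subfields, generated subfields,
  dimensions and algebraicity are taken from HOL-Algebra for the ring \<open>ring_of_type_algebra\<close>
  on the whole type.  The characteristic \<open>p\<close> is \<open>CHAR('a)\<close>.\<close>

definition adjoin :: "'a::field set \<Rightarrow> 'a set \<Rightarrow> 'a set" where
  "adjoin k S = generate_field ring_of_type_algebra (k \<union> S)"

definition perfect_subfield :: "'a::field set \<Rightarrow> bool" where
  "perfect_subfield Q \<longleftrightarrow>
     subfield Q ring_of_type_algebra \<and> (\<lambda>x. x ^ CHAR('a)) ` Q = Q"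

text \<open>A polynomial in indeterminates indexed by \<open>'i\<close> is a finitely supported map from monomials
  to coefficients, a monomial being a finitely supported map from indices to exponents.\<close>

definition mpoly_eval :: "('i \<Rightarrow> 'a::field) \<Rightarrow> (('i \<Rightarrow>\<^sub>0 nat) \<Rightarrow>\<^sub>0 'a) \<Rightarrow> 'a" where
  "mpoly_eval x P =
     (\<Sum>m\<in>Poly_Mapping.keys P.
        Poly_Mapping.lookup P m * (\<Prod>i\<in>Poly_Mapping.keys m. x i ^ Poly_Mapping.lookup m i))"

definition alg_independent :: "'a::field set \<Rightarrow> 'i set \<Rightarrow> ('i \<Rightarrow> 'a) \<Rightarrow> bool" where
  "alg_independent Q I x \<longleftrightarrow>
     (\<forall>P :: ('i \<Rightarrow>\<^sub>0 nat) \<Rightarrow>\<^sub>0 'a.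
        range (Poly_Mapping.lookup P) \<subseteq> Q \<longrightarrow>
        (\<forall>m\<in>Poly_Mapping.keys P. Poly_Mapping.keys m \<subseteq> I) \<longrightarrow>
        mpoly_eval x P = 0 \<longrightarrow> P = 0)"


subsection \<open>Purely inseparable extensions\<close>

definition purely_inseparable :: "'a::field set \<Rightarrow> 'a set \<Rightarrow> bool" where
  "purely_inseparable k K \<longleftrightarrow>
     subfield k ring_of_type_algebra \<and> subfield K ring_of_type_algebra \<and> k \<subseteq> K \<and>
     (\<forall>x\<in>K. \<exists>n. x ^ (CHAR('a) ^ n) \<in> k)"

text \<open>The intermediate field written \<open>k\<^sub>n\<close>.\<close>

definition root_layer :: "'a::field set \<Rightarrow> 'a set \<Rightarrow> nat \<Rightarrow> 'a set" where
  "root_layer k K n = {x \<in> K. x ^ (CHAR('a) ^ n) \<in> k}"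

definition lq_finite :: "'a::field set \<Rightarrow> 'a set \<Rightarrow> bool" where
  "lq_finite k K \<longleftrightarrow>
     purely_inseparable k K \<and>
     (\<forall>n\<ge>1. ring.finite_dimension ring_of_type_algebra k (root_layer k K n))"

definition r_base :: "'a::field set \<Rightarrow> 'a set \<Rightarrow> 'a set \<Rightarrow> bool" where
  "r_base k K B \<longleftrightarrow>
     (let F = adjoin k ((\<lambda>x. x ^ CHAR('a)) ` K)
      in B \<subseteq> K \<and> K = adjoin F B \<and> (\<forall>x\<in>B. x \<notin> adjoin F (B - {x})))"

text \<open>The supremum of the cardinalities of a family of subsets of \<open>'a\<close>, as a cardinal order on
  \<open>'a\<close>.  It suffices to compare with upper bounds on \<open>'a\<close>, as all these cardinalities are bounded
  by that of \<open>'a\<close> itself; the supremum is unique up to \<open>=o\<close>.\<close>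

definition card_Sup :: "'a set set \<Rightarrow> 'a rel" where
  "card_Sup \<B> =
     (SOME c. Card_order c \<and> (\<forall>B\<in>\<B>. |B| \<le>o c) \<and>
        (\<forall>c' :: 'a rel. Card_order c' \<and> (\<forall>B\<in>\<B>. |B| \<le>o c') \<longrightarrow> c \<le>o c'))"

lemma card_Sup:
  fixes \<B> :: "'a set set"
  shows "Card_order (card_Sup \<B>)"
    and "B \<in> \<B> \<Longrightarrow> |B| \<le>o card_Sup \<B>"
    and "Card_order (c :: 'a rel) \<Longrightarrow> (\<And>B. B \<in> \<B> \<Longrightarrow> |B| \<le>o c) \<Longrightarrow> card_Sup \<B> \<le>o c"
proof -
  let ?U = "{c :: 'a rel. Card_order c \<and> (\<forall>B\<in>\<B>. |B| \<le>o c)}"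
  have "|UNIV :: 'a set| \<in> ?U"
    by (auto intro: card_of_mono1 card_of_Card_order)
  then obtain d where "d \<in> ?U" "\<forall>c'\<in>?U. d \<le>o c'"
    using exists_minim_Card_order[of ?U] by blast
  then have "\<exists>c :: 'a rel. Card_order c \<and> (\<forall>B\<in>\<B>. |B| \<le>o c) \<and>
      (\<forall>c' :: 'a rel. Card_order c' \<and> (\<forall>B\<in>\<B>. |B| \<le>o c') \<longrightarrow> c \<le>o c')"
    by blast
  from someI_ex[OF this]
  show "Card_order (card_Sup \<B>)"
    and "B \<in> \<B> \<Longrightarrow> |B| \<le>o card_Sup \<B>"
    and "Card_order (c :: 'a rel) \<Longrightarrow> (\<And>B. B \<in> \<B> \<Longrightarrow> |B| \<le>o c) \<Longrightarrow> card_Sup \<B> \<le>o c"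
    unfolding card_Sup_def by blast+
qed

text \<open>As all \<open>r\<close>-bases of \<open>k\<^sub>n/k\<close> have the same cardinality, the supremum may range over all of
  them instead of over one chosen \<open>B\<^sub>n\<close> for each \<open>n\<close>.\<close>

definition irrationality_degree :: "'a::field set \<Rightarrow> 'a set \<Rightarrow> 'a rel" where
  "irrationality_degree k K = card_Sup {B. \<exists>n\<ge>1. r_base k (root_layer k K n) B}"


subsection \<open>The extension\<close>

datatype indet = Ind_X | Ind_Y nat | Ind_Z nat

fun indet_val :: "'a \<Rightarrow> (nat \<Rightarrow> 'a) \<Rightarrow> (nat \<Rightarrow> 'a) \<Rightarrow> indet \<Rightarrow> 'a" where
  "indet_val x y z Ind_X = x"
| "indet_val x y z (Ind_Y i) = y i"
| "indet_val x y z (Ind_Z i) = z i"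

text \<open>The families \<open>y\<close> and \<open>z\<close> are indexed from 1; their values at 0 are never used.\<close>

definition indets :: "indet set" where
  "indets = {Ind_X} \<union> Ind_Y ` {1..} \<union> Ind_Z ` {1..}"

definition base_field :: "'a::field set \<Rightarrow> 'a \<Rightarrow> (nat \<Rightarrow> 'a) \<Rightarrow> (nat \<Rightarrow> 'a) \<Rightarrow> 'a set" where
  "base_field Q x y z = adjoin Q (indet_val x y z ` indets)"

text \<open>\<open>proot m a\<close> is the root of \<open>a\<close> of order \<open>CHAR('a) ^ m\<close>, written \<open>a\<close> to the power
  \<open>p\<close> to the power \<open>-m\<close>.  It exists and is unique in an algebraically closed field of positive
  characteristic.\<close>

definition proot :: "nat \<Rightarrow> 'a::field \<Rightarrow> 'a" where
  "proot m a = (THE b. b ^ (CHAR('a) ^ m) = a)"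

definition alpha :: "'a::field \<Rightarrow> (nat \<Rightarrow> 'a) \<Rightarrow> (nat \<Rightarrow> 'a) \<Rightarrow> nat \<Rightarrow> nat \<Rightarrow> 'a" where
  "alpha x y z n j = proot (n - j) (z j) * proot n x + proot (n - j) (y j)"

definition ext_stage ::
    "'a::field set \<Rightarrow> 'a \<Rightarrow> (nat \<Rightarrow> 'a) \<Rightarrow> (nat \<Rightarrow> 'a) \<Rightarrow> nat \<Rightarrow> 'a set" where
  "ext_stage Q x y z n =
     adjoin (base_field Q x y z) ({proot n x} \<union> alpha x y z n ` {1..n-1})"

definition ext_field :: "'a::field set \<Rightarrow> 'a \<Rightarrow> (nat \<Rightarrow> 'a) \<Rightarrow> (nat \<Rightarrow> 'a) \<Rightarrow> 'a set" where
  "ext_field Q x y z = (\<Union>n\<in>{2..}. ext_stage Q x y z n)"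

end

theory Submission
  imports Defs
begin

text \<open>
  The point of the construction is that \<open>k\<^sub>n = K\<^sub>n\<close> for every \<open>n \<ge> 1\<close>, where \<open>K\<^sub>1\<close> stands for
  \<open>k(X ^ (1/p))\<close>; this is \<open>root_layer_eq_stage\<close>. As \<open>K\<^sub>n\<close> is generated over \<open>k\<close> by \<open>n\<close> algebraic
  elements, \<open>k\<^sub>n/k\<close> is finite. Moreover the \<open>p\<close>-th powers of \<open>K\<^sub>n\<close> lie in \<open>K\<^sub>n\<^sub>-\<^sub>1\<close>, and the \<open>n\<close> generators
  are \<open>p\<close>-independent over \<open>K\<^sub>n\<^sub>-\<^sub>1\<close>; so they are an \<open>r\<close>-base of \<open>k\<^sub>n/k\<close> with \<open>n\<close> elements
  (\<open>stage_r_base\<close>), and the degree of irrationality exceeds every \<open>n\<close>.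

  Both facts, \<open>k\<^sub>n = K\<^sub>n\<close> and \<open>p\<close>-independence, come from derivations. Let \<open>T\<close> be the root of \<open>X\<close>
  of order \<open>p ^ m\<close>, and let \<open>D = d/dT\<close> on the field of rational functions in \<open>T\<close> over the perfect
  closure of \<open>Q(Y, Z)\<close> (\<open>derivation_x\<close>). Then \<open>D\<close> kills \<open>K\<^sub>m\<^sub>-\<^sub>1\<close>, it kills every element whose
  \<open>p ^ n\<close>-th power is in \<open>k\<close> for some \<open>n < m\<close>, and it sends the generators \<open>T\<close> and \<open>\<alpha>\<^sub>j\<close> of \<open>K\<^sub>m\<close>
  to \<open>1\<close> and \<open>\<zeta>\<^sub>j\<close>, the root of \<open>Z\<^sub>j\<close> of order \<open>p ^ (m - j)\<close>. These values are linearly independent over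
  \<open>K\<^sub>m\<close> (\<open>roots_z_independent\<close>): writing \<open>\<alpha>\<^sub>j = \<zeta>\<^sub>j T + \<eta>\<^sub>j\<close>, the derivation \<open>d/d\<zeta>\<^sub>i - T d/d\<eta>\<^sub>i\<close> kills
  \<open>K\<^sub>m\<close>, including \<open>\<alpha>\<^sub>i\<close>, and kills all \<open>\<zeta>\<^sub>j\<close> except \<open>\<zeta>\<^sub>i\<close> (\<open>derivation_z\<close>).

  A general argument finishes the proof. If \<open>D\<close> kills \<open>L\<close> and has linearly independent values on
  finitely many \<open>p\<close>-th roots of elements of \<open>L\<close>, then these roots are \<open>p\<close>-independent over \<open>L\<close>
  (\<open>derivation_p_independent\<close>), and the constants of \<open>D\<close> in the field they generate are just \<open>L\<close>
  (\<open>derivation_constants\<close>). With \<open>L = K\<^sub>m\<^sub>-\<^sub>1\<close> the latter says that an element of \<open>K\<^sub>m\<close> whose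
  \<open>p ^ n\<close>-th power lies in \<open>k\<close>, \<open>n < m\<close>, already lies in \<open>K\<^sub>m\<^sub>-\<^sub>1\<close>; repeating this leads down to \<open>K\<^sub>n\<close>.

  Algebraic independence enters only through the existence of the partial derivatives: an
  indeterminate, and then each of its roots, is transcendental over the perfect closure of the field
  generated by the other indeterminates.
\<close>

section \<open>Subfields of the ambient field\<close>

abbreviation ambient :: "'a::field ring" where
  "ambient \<equiv> ring_of_type_algebra"

lemma ambient_simps:
  "carrier (ambient :: 'a::field ring) = UNIV"
  "(a :: 'a) \<otimes>\<^bsub>ambient\<^esub> b = a * b" "\<one>\<^bsub>ambient\<^esub> = (1 :: 'a)"
  "a \<oplus>\<^bsub>ambient\<^esub> b = a + b" "\<zero>\<^bsub>ambient\<^esub> = (0 :: 'a)"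
  by (simp_all add: ring_of_type_algebra_def)

lemma ambient_uminus: "\<ominus>\<^bsub>ambient\<^esub> a = - (a :: 'a::field)"
proof -
  interpret field "ambient :: 'a ring" by (rule field_from_type_algebra)
  have "- a \<oplus>\<^bsub>ambient\<^esub> a = \<zero>\<^bsub>ambient\<^esub>" by (simp add: ambient_simps)
  then show ?thesis by (intro minus_equality) (auto simp: ambient_simps)
qed

lemma ambient_inverse:
  assumes "(a :: 'a::field) \<noteq> 0"
  shows "inv\<^bsub>ambient\<^esub> a = inverse a"
proof -
  interpret field "ambient :: 'a ring" by (rule field_from_type_algebra)
  show ?thesis by (rule comm_inv_char) (use assms in \<open>auto simp: ambient_simps\<close>)
qed

lemma subfieldI_ambient:
  fixes K :: "'a::field set"
  assumes "1 \<in> K" "\<And>a b. a \<in> K \<Longrightarrow> b \<in> K \<Longrightarrow> a + b \<in> K"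
    "\<And>a. a \<in> K \<Longrightarrow> - a \<in> K" "\<And>a b. a \<in> K \<Longrightarrow> b \<in> K \<Longrightarrow> a * b \<in> K"
    "\<And>a. a \<in> K \<Longrightarrow> a \<noteq> 0 \<Longrightarrow> inverse a \<in> K"
  shows "subfield K ambient"
proof -
  interpret field "ambient :: 'a ring" by (rule field_from_type_algebra)
  show ?thesis
    by (rule subfieldI', rule subringI)
       (use assms in \<open>auto simp: ambient_simps ambient_uminus ambient_inverse\<close>)
qed

context
  fixes K :: "'a::field set"
  assumes K: "subfield K ambient"
begin

interpretation field "ambient :: 'a ring" by (rule field_from_type_algebra)

lemma subfield_1: "1 \<in> K"
  and subfield_0: "0 \<in> K"
  and subfield_uminus: "a \<in> K \<Longrightarrow> - a \<in> K"
  and subfield_mult: "a \<in> K \<Longrightarrow> b \<in> K \<Longrightarrow> a * b \<in> K"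
  and subfield_add: "a \<in> K \<Longrightarrow> b \<in> K \<Longrightarrow> a + b \<in> K"
  using subringE(2,3,5,6,7)[OF subfieldE(1)[OF K]] by (auto simp: ambient_simps ambient_uminus)

lemma subfield_inverse: "a \<in> K \<Longrightarrow> inverse a \<in> K"
  using subfield_m_inv(1)[OF K, of a] subfield_0
  by (cases "a = 0") (auto simp: ambient_simps ambient_inverse)

lemma subfield_diff: "a \<in> K \<Longrightarrow> b \<in> K \<Longrightarrow> a - b \<in> K"
  using subfield_add[of a "- b"] subfield_uminus[of b] by simp

lemma subfield_power: "a \<in> K \<Longrightarrow> a ^ n \<in> K"
  by (induction n) (auto intro: subfield_mult subfield_1)

lemma subfield_of_nat: "of_nat n \<in> K"
  by (induction n) (auto intro: subfield_add subfield_1 subfield_0)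

lemma subfield_sum: "(\<And>i. i \<in> A \<Longrightarrow> f i \<in> K) \<Longrightarrow> sum f A \<in> K"
  by (induction A rule: infinite_finite_induct) (auto intro: subfield_add subfield_0)

end

lemmas subfield_closed = subfield_0 subfield_1 subfield_uminus subfield_mult subfield_add
  subfield_inverse subfield_diff subfield_power subfield_of_nat subfield_sum

lemma subfield_Int:
  assumes "subfield K ambient" "subfield L (ambient :: 'a::field ring)"
  shows "subfield (K \<inter> L) ambient"
  by (rule subfieldI_ambient) (use assms in \<open>auto intro: subfield_closed\<close>)

lemma adjoin_subfield: "subfield (adjoin k S) (ambient :: 'a::field ring)"
proof -
  interpret field "ambient :: 'a ring" by (rule field_from_type_algebra)
  show ?thesis unfolding adjoin_def
    by (rule generate_field_is_subfield) (simp add: ambient_simps)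
qed

lemma adjoin_base: "k \<subseteq> adjoin k S"
  unfolding adjoin_def by (auto intro: generate_field.incl)

lemma adjoin_generator: "S \<subseteq> adjoin k S"
  unfolding adjoin_def by (auto intro: generate_field.incl)

lemma adjoin_baseI: "a \<in> k \<Longrightarrow> a \<in> adjoin k S"
  and adjoin_generatorI: "a \<in> S \<Longrightarrow> a \<in> adjoin k S"
  using adjoin_base[of k S] adjoin_generator[of S k] by auto

lemma adjoin_least:
  assumes "subfield E (ambient :: 'a::field ring)" "k \<subseteq> E" "S \<subseteq> E"
  shows "adjoin k S \<subseteq> E"
proof -
  interpret field "ambient :: 'a ring" by (rule field_from_type_algebra)
  show ?thesis unfolding adjoin_def
    using generate_field_min_subfield1[OF _ assms(1), of "k \<union> S"] assms
    by (auto simp: ambient_simps)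
qed

lemma adjoin_mono: "k \<subseteq> k' \<Longrightarrow> S \<subseteq> S' \<Longrightarrow> adjoin k S \<subseteq> adjoin k' (S' :: 'a::field set)"
  using adjoin_base[of k' S'] adjoin_generator[of S' k'] by (intro adjoin_least adjoin_subfield) auto

lemma adjoin_absorb:
  assumes "subfield k (ambient :: 'a::field ring)" "S \<subseteq> k"
  shows "adjoin k S = k"
  using adjoin_least[OF assms(1) order_refl assms(2)] adjoin_base[of k S] by auto

text \<open>The quotients of a ring form a field. This is how a generated field is made accessible below:
  once as quotients of one-variable polynomials in a single generator, once as quotients of
  polynomials in all the indeterminates.\<close>

lemma adjoin_fractions:
  assumes R: "1 \<in> R" "\<And>a b. a \<in> R \<Longrightarrow> b \<in> R \<Longrightarrow> a + b \<in> R"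
      "\<And>a b. a \<in> R \<Longrightarrow> b \<in> R \<Longrightarrow> a * b \<in> R" "\<And>a. a \<in> R \<Longrightarrow> - a \<in> R"
    and "k \<union> S \<subseteq> R" and "u \<in> adjoin k S"
  shows "\<exists>a\<in>R. \<exists>b\<in>R. b \<noteq> 0 \<and> u = a / (b :: 'a::field)"
proof -
  let ?E = "{u. \<exists>a\<in>R. \<exists>b\<in>R. b \<noteq> 0 \<and> u = a / b}"
  have I: "u \<in> ?E" if "a \<in> R" "b \<in> R" "b \<noteq> 0" "u = a / b" for u a b using that by blast
  have "subfield ?E ambient"
  proof (rule subfieldI_ambient)
    show "1 \<in> ?E" by (rule I[of 1 1]) (auto intro: R)
  next
    fix u v assume "u \<in> ?E" "v \<in> ?E"
    then obtain a b c d where *: "a \<in> R" "b \<in> R" "b \<noteq> 0" "u = a / b"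
      "c \<in> R" "d \<in> R" "d \<noteq> 0" "v = c / d" by blast
    show "u + v \<in> ?E"
      by (rule I[of "a * d + c * b" "b * d"]) (use * in \<open>auto intro!: R(2,3) simp: add_frac_eq\<close>)
    show "u * v \<in> ?E"
      by (rule I[of "a * c" "b * d"]) (use * in \<open>auto intro!: R(3)\<close>)
  next
    fix u assume "u \<in> ?E"
    then obtain a b where *: "a \<in> R" "b \<in> R" "b \<noteq> 0" "u = a / b" by blast
    show "- u \<in> ?E" by (rule I[of "- a" b]) (use * in \<open>auto intro!: R(4)\<close>)
    show "inverse u \<in> ?E" if "u \<noteq> 0" by (rule I[of b a]) (use * that in auto)
  qed
  moreover have "a \<in> ?E" if "a \<in> R" for a
    by (rule I[OF that R(1)]) auto
  ultimately have "adjoin k S \<subseteq> ?E"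
    using assms(5) by (intro adjoin_least) blast+
  then show ?thesis using assms(6) by blast
qed

text \<open>The iterated simple extension by finitely many algebraic elements is already a field, so it is
  the generated field, and it is finite by the tower law.\<close>

lemma finite_dimension_adjoin:
  assumes "algebraic_closure ambient (k :: 'a::field set)" "finite S"
  shows "ring.finite_dimension ambient k (adjoin k S)"
proof -
  interpret algebraic_closure "ambient :: 'a ring" k by fact
  obtain xs where xs: "set xs = S" using assms(2) finite_list by blast
  have k: "subfield k (ambient :: 'a ring)" by (rule subfield_axioms)
  have alg: "\<And>x. (algebraic over k) x" 
    by (rule algebraic_extension) (simp add: ambient_simps)
  have S: "set xs \<subseteq> carrier ambient" by (simp add: ambient_simps)
  have "adjoin k S = finite_extension k xs"
  proof
    show "adjoin k S \<subseteq> finite_extension k xs"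
      using finite_extension_is_subfield[OF k S] alg finite_extension_mem[OF subfieldE(1)[OF k] S]
        finite_extension_incl[OF subfieldE(3)[OF k] S] xs
      by (intro adjoin_least) auto
    show "finite_extension k xs \<subseteq> adjoin k S"
      by (rule finite_extension_subring_incl)
         (use adjoin_base[of k S] adjoin_generator[of S k] xs in
           \<open>auto intro: subfieldE(1) adjoin_subfield\<close>)
  qed
  then show ?thesis using finite_extension_finite_dimension(1)[OF k S] alg by simp
qed

section \<open>Frobenius and perfect closures\<close>

context
  assumes char: "CHAR('a::field) > 0"
begin

lemma prime_char: "prime CHAR('a)"
  using char by (rule prime_CHAR_semidom)

lemma frob_add: "(a + b :: 'a) ^ CHAR('a) ^ n = a ^ CHAR('a) ^ n + b ^ CHAR('a) ^ n"
  by (rule freshmans_dream'[OF prime_char refl])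

lemma frob_sum: "(sum f A :: 'a) ^ CHAR('a) ^ n = (\<Sum>i\<in>A. f i ^ CHAR('a) ^ n)"
  by (rule freshmans_dream_sum'[OF prime_char refl])

lemma frob_uminus: "(- a :: 'a) ^ CHAR('a) ^ n = - (a ^ CHAR('a) ^ n)"
proof -
  have "(- a) ^ CHAR('a) ^ n + a ^ CHAR('a) ^ n = 0"
    using frob_add[of "- a" a n] char by (simp add: power_0_left)
  then show ?thesis by (simp add: eq_neg_iff_add_eq_0)
qed

lemma frob_inj: "(a :: 'a) ^ CHAR('a) ^ n = b ^ CHAR('a) ^ n \<longleftrightarrow> a = b"
proof
  assume "a ^ CHAR('a) ^ n = b ^ CHAR('a) ^ n"
  then have "(a + - b) ^ CHAR('a) ^ n = 0" unfolding frob_add frob_uminus by simp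
  then show "a = b" by simp
qed simp

lemma subfield_frob_preimage:
  assumes "subfield K (ambient :: 'a ring)"
  shows "subfield {a. a ^ CHAR('a) ^ n \<in> K} ambient"
  by (rule subfieldI_ambient)
     (use assms in \<open>auto simp: frob_add frob_uminus power_mult_distrib power_inverse
        intro: subfield_closed\<close>)

text \<open>Frobenius is an injective field homomorphism. Comparing the base field with the \<open>p\<^sup>n\<close>-th powers of
  some field \<open>C\<close> therefore locates all \<open>p\<^sup>n\<close>-th roots of elements of the base field inside \<open>C\<close>.\<close>

lemma subfield_frob_image:
  assumes "subfield K (ambient :: 'a ring)"
  shows "subfield ((\<lambda>a. a ^ CHAR('a) ^ n) ` K) ambient"
proof (rule subfieldI_ambient)
  show "1 \<in> (\<lambda>a. a ^ CHAR('a) ^ n) ` K" using subfield_1[OF assms] by (auto intro!: image_eqI[of _ _ 1])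
qed (use assms in \<open>auto simp flip: frob_add frob_uminus power_mult_distrib power_inverse
        intro!: imageI intro: subfield_closed\<close>)

end

definition perfect_closure :: "'a::field set \<Rightarrow> 'a set" where
  "perfect_closure K = {a. \<exists>n. a ^ CHAR('a) ^ n \<in> K}"

lemma perfect_closure_level:
  assumes "subfield K (ambient :: 'a::field ring)" "a ^ CHAR('a) ^ n \<in> K" "n \<le> m"
  shows "a ^ CHAR('a) ^ m \<in> K"
proof -
  have "a ^ CHAR('a) ^ m = (a ^ CHAR('a) ^ n) ^ CHAR('a) ^ (m - n)"
    using assms(3) by (simp flip: power_mult power_add)
  then show ?thesis using assms(2) subfield_power[OF assms(1)] by simp
qed

lemma subfield_perfect_closure:
  assumes char: "CHAR('a::field) > 0" and K: "subfield K (ambient :: 'a ring)"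
  shows "subfield (perfect_closure K) ambient"
proof -
  have common: "\<exists>n. a ^ CHAR('a) ^ n \<in> K \<and> b ^ CHAR('a) ^ n \<in> K"
    if "a \<in> perfect_closure K" "b \<in> perfect_closure K" for a b
  proof -
    from that obtain m n where "a ^ CHAR('a) ^ m \<in> K" "b ^ CHAR('a) ^ n \<in> K"
      by (auto simp: perfect_closure_def)
    then show ?thesis 
      using perfect_closure_level[OF K, of a m "max m n"] perfect_closure_level[OF K, of b n "max m n"]
      by auto
  qed
  have cl: "f a b \<in> perfect_closure K"
    if "\<And>n E. subfield E (ambient :: 'a ring) \<Longrightarrow> a \<in> E \<Longrightarrow> b \<in> E \<Longrightarrow> f a b \<in> E" 
      "a \<in> perfect_closure K" "b \<in> perfect_closure K" for a b and f :: "'a \<Rightarrow> 'a \<Rightarrow> 'a"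
  proof -
    from common[OF that(2,3)] obtain n where "a ^ CHAR('a) ^ n \<in> K" "b ^ CHAR('a) ^ n \<in> K" by auto
    with that(1)[OF subfield_frob_preimage[OF char K, of n]] show ?thesis
      by (auto simp: perfect_closure_def)
  qed
  show ?thesis
  proof (rule subfieldI_ambient)
    show "1 \<in> perfect_closure K" using subfield_1[OF K] by (auto simp: perfect_closure_def)
    show "- a \<in> perfect_closure K" if "a \<in> perfect_closure K" for a
      using cl[of a a "\<lambda>a b. - a"] that by (auto intro: subfield_closed)
    show "inverse a \<in> perfect_closure K" if "a \<in> perfect_closure K" for a
      using cl[of a a "\<lambda>a b. inverse a"] that by (auto intro: subfield_closed)
  qed (auto intro: cl subfield_closed)
qed

lemma perfect_closureI: "a \<in> K \<Longrightarrow> a \<in> perfect_closure K"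
  by (auto simp: perfect_closure_def intro!: exI[of _ 0])

lemma perfect_closure_root: "a ^ CHAR('a) ^ n \<in> perfect_closure K \<Longrightarrow> a \<in> perfect_closure (K :: 'a::field set)"
  by (auto simp: perfect_closure_def simp flip: power_mult power_add)

section \<open>Roots of \<open>p\<close>-power order\<close>

lemma ambient_pow: "(a :: 'a::field) [^]\<^bsub>ambient\<^esub> (n :: nat) = a ^ n"
proof -
  interpret field "ambient :: 'a ring" by (rule field_from_type_algebra)
  show ?thesis by (induction n) (auto simp: ambient_simps)
qed

lemma algebraic_closure_root_exists:
  assumes "algebraic_closure ambient (k :: 'a::field set)" "n > 0"
  shows "\<exists>b :: 'a. b ^ n = a"
proof -
  interpret algebraic_closure "ambient :: 'a ring" k by fact
  let ?P = "1 # replicate (n - 1) 0 @ [- a] :: 'a list"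
  have P: "?P \<in> carrier (poly_ring ambient)"
    by (auto simp: univ_poly_def polynomial_def ambient_simps)
  have "splitted ?P" by (rule roots_over_carrier[OF P])
  moreover have "Polynomials.degree ?P = n" using assms(2) by simp
  ultimately have "roots ?P \<noteq> {#}" using assms(2) unfolding splitted_def by auto
  then obtain b where "b \<in># roots ?P" by blast
  then have b: "is_root ?P b" using roots_mem_iff_is_root[OF P] by auto
  have ev: "eval (replicate m 0 @ [- a]) b = - a" for m
    by (induction m) (auto simp: ambient_simps)
  have "eval ?P b = b ^ n - a"
    using ev[of "n - 1"] assms(2) by (simp add: ambient_simps ambient_pow)
  then show ?thesis using b by (auto simp: is_root_def ambient_simps)
qed

lemma proot_unique:
  assumes "CHAR('a::field) > 0" "b ^ CHAR('a) ^ m = (a :: 'a)"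
  shows "proot m a = b"
  unfolding proot_def using assms frob_inj[OF assms(1)] by blast

lemma proot_power:
  assumes "CHAR('a::field) > 0" "algebraic_closure ambient (k :: 'a set)"
  shows "proot m a ^ CHAR('a) ^ m = (a :: 'a)"
proof -
  obtain b where "b ^ CHAR('a) ^ m = a"
    using algebraic_closure_root_exists[OF assms(2), of "CHAR('a) ^ m" a] assms(1) by auto
  then show ?thesis using proot_unique[OF assms(1), of b m a] by simp
qed

section \<open>Derivations\<close>

definition derivation_on :: "'a::field set \<Rightarrow> ('a \<Rightarrow> 'a) \<Rightarrow> bool" where
  "derivation_on M D \<longleftrightarrow>
     (\<forall>a\<in>M. \<forall>b\<in>M. D (a + b) = D a + D b \<and> D (a * b) = a * D b + D a * b)"

context
  fixes M :: "'a::field set" and D :: "'a \<Rightarrow> 'a"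
  assumes D: "derivation_on M D" and M: "subfield M ambient"
begin

lemma derivation_add: "a \<in> M \<Longrightarrow> b \<in> M \<Longrightarrow> D (a + b) = D a + D b"
  and derivation_mult: "a \<in> M \<Longrightarrow> b \<in> M \<Longrightarrow> D (a * b) = a * D b + D a * b"
  using D unfolding derivation_on_def by auto

lemma derivation_0: "D 0 = 0"
  using derivation_add[of 0 0] subfield_0[OF M] by (metis add_cancel_right_right)

lemma derivation_1: "D 1 = 0"
  using derivation_mult[of 1 1] subfield_1[OF M] by (metis add_cancel_right_right mult_1 mult_1_right)

lemma derivation_uminus: "a \<in> M \<Longrightarrow> D (- a) = - D a"
  using derivation_add[of a "- a"] subfield_uminus[OF M, of a] derivation_0
  by (simp add: add_eq_0_iff2 add.commute)

lemma derivation_inverse: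
  assumes "a \<in> M" "a \<noteq> 0"
  shows "D (inverse a) = - D a * inverse a * inverse a"
proof -
  have "a * D (inverse a) + D a * inverse a = 0"
    using derivation_mult[of a "inverse a"] subfield_inverse[OF M] assms derivation_1 by simp
  then have "a * D (inverse a) = - D a * inverse a"
    by (simp add: eq_neg_iff_add_eq_0)
  then show ?thesis using assms(2) by (simp add: field_simps)
qed

lemma derivation_power:
  assumes "a \<in> M"
  shows "D (a ^ n) = of_nat n * a ^ (n - 1) * D a"
proof (induction n)
  case (Suc n)
  have "D (a ^ Suc n) = a * D (a ^ n) + D a * a ^ n"
    using derivation_mult[OF assms subfield_power[OF M assms]] by simp
  also have "\<dots> = of_nat (Suc n) * a ^ n * D a"
    unfolding Suc.IH by (cases n) (simp_all add: algebra_simps)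
  finally show ?case by simp
qed (simp add: derivation_1)

lemma derivation_frob:
  assumes "a \<in> M" "n > 0"
  shows "D (a ^ CHAR('a) ^ n) = 0"
  using assms by (simp add: derivation_power)

lemma derivation_sum: "(\<And>i. i \<in> A \<Longrightarrow> f i \<in> M) \<Longrightarrow> D (sum f A) = (\<Sum>i\<in>A. D (f i))"
proof (induction A rule: infinite_finite_induct)
  case (insert i A)
  then show ?case using derivation_add[of "f i" "sum f A"] subfield_sum[OF M, of A f] by simp
qed (simp_all add: derivation_0)

lemma subfield_constants: "subfield {a \<in> M. D a = 0} ambient"
  by (rule subfieldI_ambient)
     (use M in \<open>auto simp: derivation_add derivation_mult derivation_uminus derivation_inverse
        derivation_1 intro: subfield_closed\<close>)

text \<open>The elements whose derivative is a combination of the given values form a subfield, by the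
  Leibniz rule; so it is enough that the generators have this property.\<close>

lemma derivation_adjoin_span:
  assumes L: "L \<subseteq> {a \<in> M. D a = 0}" and J: "finite J" "b ` J \<subseteq> M"
    and u: "u \<in> adjoin L (b ` J)"
  shows "\<exists>c. (\<forall>j\<in>J. c j \<in> adjoin L (b ` J)) \<and> D u = (\<Sum>j\<in>J. c j * D (b j))"
proof -
  define E where "E = adjoin L (b ` J)"
  define P where "P = (\<lambda>u. \<exists>c. (\<forall>j\<in>J. c j \<in> E) \<and> D u = (\<Sum>j\<in>J. c j * D (b j)))"
  have E: "subfield E ambient" unfolding E_def by (rule adjoin_subfield)
  have EM: "E \<subseteq> M" unfolding E_def using L J by (intro adjoin_least M) auto
  have comb: "P w" if "P u" "P v" "s \<in> E" "t \<in> E" "D w = s * D u + t * D v" for u v w s t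
  proof -
    from that obtain c d where "\<forall>j\<in>J. c j \<in> E" "D u = (\<Sum>j\<in>J. c j * D (b j))"
      "\<forall>j\<in>J. d j \<in> E" "D v = (\<Sum>j\<in>J. d j * D (b j))" unfolding P_def by blast
    with that show ?thesis unfolding P_def
      by (intro exI[of _ "\<lambda>j. s * c j + t * d j"])
         (auto simp: algebra_simps sum.distrib sum_distrib_left intro!: subfield_closed[OF E])
  qed
  have P0: "P u" if "D u = 0" for u
    unfolding P_def using that subfield_0[OF E] by (intro exI[of _ "\<lambda>_. 0"]) auto
  have "subfield {u \<in> E. P u} ambient"
  proof (rule subfieldI_ambient)
    show "1 \<in> {u \<in> E. P u}" using P0 derivation_1 subfield_1[OF E] by auto
  next
    fix u v assume u: "u \<in> {u \<in> E. P u}" and v: "v \<in> {u \<in> E. P u}"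
    have [simp]: "u \<in> M" "v \<in> M" using u v EM by auto
    show "u + v \<in> {u \<in> E. P u}"
      using comb[of u v 1 1 "u + v"] u v by (auto simp: derivation_add intro!: subfield_closed[OF E])
    show "u * v \<in> {u \<in> E. P u}"
      using comb[of u v v u "u * v"] u v
      by (auto simp: derivation_mult algebra_simps intro!: subfield_closed[OF E])
  next
    fix u assume u: "u \<in> {u \<in> E. P u}"
    then have [simp]: "u \<in> M" using EM by auto
    show "- u \<in> {u \<in> E. P u}"
      using comb[of u u "-1" 0 "- u"] u
      by (auto simp: derivation_uminus intro!: subfield_closed[OF E])
    assume "u \<noteq> 0"
    then show "inverse u \<in> {u \<in> E. P u}"
      using comb[of u u "- inverse u * inverse u" 0 "inverse u"] u
      by (auto simp: derivation_inverse intro!: subfield_closed[OF E])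
  qed
  moreover have "L \<subseteq> {u \<in> E. P u}"
    using L P0 adjoin_base[of L "b ` J"] unfolding E_def by auto
  moreover have "P (b j)" if "j \<in> J" for j
    unfolding P_def using that J(1) subfield_0[OF E] subfield_1[OF E]
    by (intro exI[of _ "\<lambda>i. if i = j then 1 else 0"]) (auto simp: if_distrib[of "\<lambda>x. x * _"] cong: if_cong)
  then have "b ` J \<subseteq> {u \<in> E. P u}"
    using adjoin_generator[of "b ` J" L] unfolding E_def by auto
  ultimately have "E \<subseteq> {u \<in> E. P u}"
    unfolding E_def by (intro adjoin_least) auto
  then show ?thesis using u unfolding E_def P_def by blast
qed

end

subsection \<open>Derivation with respect to a transcendental element\<close>

definition polys_over :: "'a::field set \<Rightarrow> 'a poly set" where
  "polys_over K = {f. \<forall>i. poly.coeff f i \<in> K}"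

definition transcendental_over :: "'a::field set \<Rightarrow> 'a \<Rightarrow> bool" where
  "transcendental_over K t \<longleftrightarrow> (\<forall>f\<in>polys_over K. poly f t = 0 \<longrightarrow> f = 0)"

context
  fixes K :: "'a::field set"
  assumes K: "subfield K ambient"
begin

lemma polys_over_add: "f \<in> polys_over K \<Longrightarrow> g \<in> polys_over K \<Longrightarrow> f + g \<in> polys_over K"
  and polys_over_diff: "f \<in> polys_over K \<Longrightarrow> g \<in> polys_over K \<Longrightarrow> f - g \<in> polys_over K"
  and polys_over_uminus: "f \<in> polys_over K \<Longrightarrow> - f \<in> polys_over K"
  and polys_over_mult: "f \<in> polys_over K \<Longrightarrow> g \<in> polys_over K \<Longrightarrow> f * g \<in> polys_over K"
  and polys_over_pderiv: "f \<in> polys_over K \<Longrightarrow> pderiv f \<in> polys_over K"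
  and polys_over_const: "a \<in> K \<Longrightarrow> [:a:] \<in> polys_over K"
  by (auto simp: polys_over_def coeff_mult coeff_pderiv coeff_pCons split: nat.split
       intro!: subfield_closed[OF K])

lemma polys_over_X: "[:0, 1:] \<in> polys_over K"
  and polys_over_1: "1 \<in> polys_over K"
  by (auto simp: polys_over_def coeff_pCons split: nat.split intro!: subfield_closed[OF K])

lemmas polys_over_closed = polys_over_add polys_over_diff polys_over_uminus polys_over_mult
  polys_over_pderiv polys_over_const polys_over_X polys_over_1

lemma adjoin_poly_fractions:
  assumes "u \<in> adjoin K {t}"
  shows "\<exists>f\<in>polys_over K. \<exists>g\<in>polys_over K. poly g t \<noteq> 0 \<and> u = poly f t / poly g t"
proof -
  let ?R = "(\<lambda>f. poly f t) ` polys_over K"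
  have const: "a \<in> ?R" if "a \<in> K" for a
    using polys_over_const[OF that] by (auto intro!: image_eqI[of _ _ "[:a:]"])
  have t: "t \<in> ?R"
    using polys_over_X by (auto intro!: image_eqI[of _ _ "[:0, 1:]"])
  have "\<exists>a\<in>?R. \<exists>b\<in>?R. b \<noteq> 0 \<and> u = a / b"
    by (rule adjoin_fractions[OF _ _ _ _ _ assms])
       (use const[OF subfield_1[OF K]] const t in
         \<open>auto simp flip: poly_add poly_mult poly_minus intro!: imageI polys_over_closed\<close>)
  then show ?thesis by blast
qed

text \<open>The formal derivative of polynomials, extended by the quotient rule. Transcendence makes it
  well defined: two fractions with the same value at \<open>t\<close> agree as rational functions.\<close>

lemma transcendental_derivation:
  assumes t: "transcendental_over K t"
  obtains D where "derivation_on (adjoin K {t}) D" "\<And>a. a \<in> K \<Longrightarrow> D a = 0" "D t = 1"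
proof -
  define q where "q f g = (poly (pderiv f) t * poly g t - poly f t * poly (pderiv g) t) /
    (poly g t * poly g t)" for f g
  define D where "D u = (THE v. \<exists>f\<in>polys_over K. \<exists>g\<in>polys_over K. poly g t \<noteq> 0 \<and>
    u = poly f t / poly g t \<and> v = q f g)" for u
  have wd: "q f g = q f' g'" if *: "f \<in> polys_over K" "g \<in> polys_over K" "poly g t \<noteq> 0"
    "f' \<in> polys_over K" "g' \<in> polys_over K" "poly g' t \<noteq> 0"
    "poly f t / poly g t = poly f' t / poly g' t" for f g f' g'
  proof -
    have "poly (f * g' - f' * g) t = 0" using * by (simp add: field_simps)
    moreover have "f * g' - f' * g \<in> polys_over K" using * by (auto intro: polys_over_closed)
    ultimately have e: "f * g' = f' * g" using t unfolding transcendental_over_def by auto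
    have e1: "poly f t * poly g' t = poly f' t * poly g t"
      using arg_cong[OF e, of "\<lambda>f. poly f t"] by simp
    have "poly (pderiv (f * g')) t = poly (pderiv (f' * g)) t" using e by simp
    then have e2: "poly (pderiv f) t * poly g' t + poly f t * poly (pderiv g') t =
        poly (pderiv f') t * poly g t + poly f' t * poly (pderiv g) t"
      by (simp add: pderiv_mult algebra_simps)
    define F G F' G' where "F = poly f t" "G = poly g t" "F' = poly f' t" "G' = poly g' t"
    define dF dG dF' dG' where "dF = poly (pderiv f) t" "dG = poly (pderiv g) t"
      "dF' = poly (pderiv f') t" "dG' = poly (pderiv g') t"
    note defs = F_G_F'_G'_def dF_dG_dF'_dG'_def
    have nz: "G \<noteq> 0" "G' \<noteq> 0" using * by (auto simp: defs)
    have a: "F = F' * G / G'" using e1 nz by (simp add: defs field_simps)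
    have b: "dF = (dF' * G + F' * dG - F * dG') / G'" using e2 nz by (simp add: defs field_simps)
    have "(dF * G - F * dG) / (G * G) = (dF' * G' - F' * dG') / (G' * G')"
      unfolding b a using nz by (simp add: field_simps)
    then show ?thesis unfolding q_def defs .
  qed
  have Dq: "D u = q f g" if "f \<in> polys_over K" "g \<in> polys_over K" "poly g t \<noteq> 0"
    "u = poly f t / poly g t" for f g u
    unfolding D_def
  proof (rule the_equality)
    show "\<exists>f'\<in>polys_over K. \<exists>g'\<in>polys_over K. poly g' t \<noteq> 0 \<and> u = poly f' t / poly g' t \<and> q f g = q f' g'"
      using that by blast
  next
    fix v assume "\<exists>f\<in>polys_over K. \<exists>g\<in>polys_over K. poly g t \<noteq> 0 \<and> u = poly f t / poly g t \<and> v = q f g"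
    then show "v = q f g" using wd that by metis
  qed
  show thesis
  proof
    show "D a = 0" if "a \<in> K" for a
      using Dq[of "[:a:]" 1 a] that by (auto simp: q_def pderiv_pCons intro: polys_over_closed)
    show "D t = 1"
      using Dq[of "[:0, 1:]" 1 t] by (auto simp: q_def pderiv_pCons intro: polys_over_closed)
    show "derivation_on (adjoin K {t}) D"
      unfolding derivation_on_def
    proof (intro ballI)
      fix u v assume "u \<in> adjoin K {t}" "v \<in> adjoin K {t}"
      then obtain f g f' g' where *: "f \<in> polys_over K" "g \<in> polys_over K" "poly g t \<noteq> 0"
        "u = poly f t / poly g t" "f' \<in> polys_over K" "g' \<in> polys_over K" "poly g' t \<noteq> 0"
        "v = poly f' t / poly g' t" using adjoin_poly_fractions by meson
      have Du: "D u = q f g" and Dv: "D v = q f' g'" using * by (auto intro: Dq)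
      have sum: "D (u + v) = q (f * g' + f' * g) (g * g')"
        by (rule Dq) (use *(1-3,5-7) in \<open>auto intro: polys_over_closed simp: *(4,8) add_frac_eq\<close>)
      have prod: "D (u * v) = q (f * f') (g * g')"
        by (rule Dq) (use * in \<open>auto intro: polys_over_closed\<close>)
      have "D (u + v) = D u + D v"
        unfolding sum Du Dv q_def using *(3,7) by (simp add: pderiv_mult pderiv_add field_simps)
      moreover have "D (u * v) = poly f t / poly g t * D v + D u * (poly f' t / poly g' t)"
        unfolding prod Du Dv q_def using *(3,7) by (simp add: pderiv_mult field_simps)
      ultimately show "D (u + v) = D u + D v \<and> D (u * v) = u * D v + D u * v"
        using *(4,8) by simp
    qed
  qed
qed

end

section \<open>Constants of a derivation in an extension of exponent one\<close>

lemma poly_closed: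
  assumes "subfield K ambient" "g \<in> polys_over K" "t \<in> K"
  shows "poly g t \<in> K"
  unfolding poly_altdef using assms(2,3)
  by (intro subfield_sum subfield_mult subfield_power assms(1)) (auto simp: polys_over_def)

context
  fixes M :: "'a::field set" and D :: "'a \<Rightarrow> 'a"
  assumes D: "derivation_on M D" and M: "subfield M ambient"
begin

lemma derivation_poly:
  assumes "g \<in> polys_over M" "t \<in> M"
  shows "D (poly g t) = poly (map_poly D g) t + poly (pderiv g) t * D t"
  using assms(1)
proof (induction g)
  case 0
  then show ?case by (simp add: derivation_0[OF D M])
next
  case (pCons a g)
  have a: "a \<in> M" and g: "g \<in> polys_over M"
    using pCons.prems by (auto simp: polys_over_def coeff_pCons split: nat.splits)
  have gt: "poly g t \<in> M" by (rule poly_closed[OF M g assms(2)])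
  have "D (poly (pCons a g) t) = D a + (t * D (poly g t) + D t * poly g t)"
    using derivation_add[OF D M a, of "t * poly g t"] derivation_mult[OF D M assms(2) gt]
      subfield_mult[OF M assms(2) gt] by simp
  also have "\<dots> = poly (map_poly D (pCons a g)) t + poly (pderiv (pCons a g)) t * D t"
    using pCons.IH[OF g] pCons.hyps
    by (simp add: map_poly_pCons derivation_0[OF D M] pderiv_pCons algebra_simps)
  finally show ?case .
qed

end

text \<open>Powers of \<open>t\<close> can be reduced below exponent \<open>p\<close>, and no inverses are needed because
  \<open>1 / u = u ^ (p - 1) / u ^ p\<close> with \<open>u ^ p\<close> in the base.\<close>

lemma adjoin_p_root_poly:
  assumes char: "CHAR('a::field) > 0" and E: "subfield E (ambient :: 'a ring)"
    and t: "t ^ CHAR('a) \<in> E" and u: "u \<in> adjoin E {t}"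
  shows "\<exists>g\<in>polys_over E. Polynomial.degree g < CHAR('a) \<and> u = poly g t"
proof -
  let ?p = "CHAR('a)"
  let ?S = "(\<lambda>g. poly g t) ` {g \<in> polys_over E. Polynomial.degree g < ?p}"
  have powers: "(\<lambda>g. poly g t) ` polys_over E \<subseteq> ?S"
  proof
    fix u assume "u \<in> (\<lambda>g. poly g t) ` polys_over E"
    then obtain g where g: "g \<in> polys_over E" "u = poly g t" by blast
    define h where "h = (\<Sum>i\<le>Polynomial.degree g.
      Polynomial.monom (poly.coeff g i * (t ^ ?p) ^ (i div ?p)) (i mod ?p))"
    have h: "poly h t = u"
      unfolding h_def g(2) poly_sum poly_monom poly_altdef[of g]
      by (intro sum.cong) (auto simp: mult.assoc simp flip: power_mult power_add)
    have h': "h \<in> polys_over E"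
      unfolding polys_over_def h_def using g(1) t
      by (auto simp: coeff_sum polys_over_def intro!: subfield_closed[OF E])
    have "Polynomial.degree h < ?p"
      unfolding h_def
      by (intro degree_sum_less char) (use char in \<open>auto intro: le_less_trans[OF degree_monom_le]\<close>)
    with h h' show "u \<in> ?S" by blast
  qed
  have frob: "poly g t ^ ?p \<in> E" if "g \<in> polys_over E" for g
  proof -
    have "poly g t ^ ?p = (\<Sum>i\<le>Polynomial.degree g. poly.coeff g i ^ ?p * (t ^ ?p) ^ i)"
      using frob_sum[OF char, of "\<lambda>i. poly.coeff g i * t ^ i" "{..Polynomial.degree g}" 1]
      by (simp add: poly_altdef power_mult_distrib mult.commute flip: power_mult)
    then show ?thesis using that t by (auto simp: polys_over_def intro!: subfield_closed[OF E])
  qed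
  note closed = polys_over_closed[OF E]
  have pow: "g ^ n \<in> polys_over E" if "g \<in> polys_over E" for g n
    using that by (induction n) (auto intro: closed)
  have "subfield ((\<lambda>g. poly g t) ` polys_over E) ambient"
  proof (rule subfieldI_ambient)
    show "1 \<in> (\<lambda>g. poly g t) ` polys_over E" by (rule image_eqI[of _ _ 1]) (auto intro: closed)
    show "inverse u \<in> (\<lambda>g. poly g t) ` polys_over E"
      if "u \<in> (\<lambda>g. poly g t) ` polys_over E" "u \<noteq> 0" for u
    proof -
      from that obtain g where g: "g \<in> polys_over E" "u = poly g t" by blast
      have "u ^ ?p = u * u ^ (?p - 1)" using char by (simp flip: power_Suc)
      then have "inverse u = poly (g ^ (?p - 1) * [:inverse (u ^ ?p):]) t"
        using that(2) g(2) by (simp add: poly_power field_simps)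
      then show ?thesis using g frob[OF g(1)]
        by (auto intro!: image_eqI[of _ _ "g ^ (?p - 1) * [:inverse (u ^ ?p):]"] closed pow subfield_inverse[OF E])
    qed
  qed (auto simp flip: poly_add poly_mult poly_minus intro!: imageI closed)
  moreover have "E \<subseteq> (\<lambda>g. poly g t) ` polys_over E"
  proof
    fix a assume "a \<in> E"
    then show "a \<in> (\<lambda>g. poly g t) ` polys_over E"
      by (intro image_eqI[of _ _ "[:a:]"]) (auto intro: closed)
  qed
  moreover have "t \<in> (\<lambda>g. poly g t) ` polys_over E"
    by (intro image_eqI[of _ _ "[:0, 1:]"]) (auto intro: closed)
  ultimately have "adjoin E {t} \<subseteq> (\<lambda>g. poly g t) ` polys_over E" by (intro adjoin_least) auto
  with powers u show ?thesis by blast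
qed

lemma degree_pderiv_le: "Polynomial.degree (pderiv g) \<le> Polynomial.degree g - 1"
  by (rule degree_le) (auto simp: coeff_pderiv coeff_eq_0)

lemma pderiv_0_low_degree:
  fixes g :: "'a::field poly"
  assumes "pderiv g = 0" "Polynomial.degree g < CHAR('a)"
  shows "Polynomial.degree g = 0"
proof (rule ccontr)
  assume n: "Polynomial.degree g \<noteq> 0"
  then have "of_nat (Polynomial.degree g) * lead_coeff g = 0"
    using arg_cong[OF assms(1), of "\<lambda>f. poly.coeff f (Polynomial.degree g - 1)"]
    by (simp add: coeff_pderiv)
  then have "CHAR('a) dvd Polynomial.degree g" using n by (auto simp: of_nat_eq_0_iff_char_dvd)
  then have "CHAR('a) \<le> Polynomial.degree g" using n by (intro dvd_imp_le) simp_all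
  with assms(2) show False by simp
qed

text \<open>Throughout, \<open>L\<close> is killed by \<open>D\<close>, and \<open>b 0, ..., b (r - 1)\<close> are \<open>p\<close>-th roots of elements of \<open>L\<close>
  whose derivatives are linearly independent over the field they generate. The conclusion is that
  they are \<open>p\<close>-independent over \<open>L\<close>, and that \<open>D\<close> has no other constants in \<open>L(b 0, ..., b (r - 1))\<close>
  than the elements of \<open>L\<close>.\<close>

context
  fixes L M :: "'a::field set" and D :: "'a \<Rightarrow> 'a" and b :: "nat \<Rightarrow> 'a" and r :: nat
  assumes char: "CHAR('a) > 0"
    and D: "derivation_on M D" and M: "subfield M ambient" and L: "subfield L ambient"
    and const: "L \<subseteq> {a \<in> M. D a = 0}"
    and gens: "b ` {..<r} \<subseteq> M"
    and roots: "\<And>j. j < r \<Longrightarrow> b j ^ CHAR('a) \<in> L"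
    and indep: "\<And>c j. (\<And>j. j < r \<Longrightarrow> c j \<in> adjoin L (b ` {..<r})) \<Longrightarrow>
      (\<Sum>j<r. c j * D (b j)) = 0 \<Longrightarrow> j < r \<Longrightarrow> c j = 0"
begin

text \<open>If \<open>b i\<close> were in the field generated by the others, its derivative would be a combination of
  theirs.\<close>

lemma derivation_p_independent:
  assumes i: "i < r"
  shows "b i \<notin> adjoin L (b ` ({..<r} - {i}))"
proof
  let ?J = "{..<r} - {i}"
  assume "b i \<in> adjoin L (b ` ?J)"
  from derivation_adjoin_span[OF D M const _ _ this] gens
  obtain c where c: "\<forall>j\<in>?J. c j \<in> adjoin L (b ` ?J)" "D (b i) = (\<Sum>j\<in>?J. c j * D (b j))"
    by auto
  have sub: "adjoin L (b ` ?J) \<subseteq> adjoin L (b ` {..<r})" by (intro adjoin_mono) auto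
  have "(\<Sum>j<r. (c(i := - 1)) j * D (b j)) = - D (b i) + (\<Sum>j\<in>?J. (c(i := - 1)) j * D (b j))"
    using i by (subst sum.remove[of _ i]) auto
  also have "(\<Sum>j\<in>?J. (c(i := - 1)) j * D (b j)) = D (b i)"
    unfolding c(2) by (intro sum.cong) auto
  finally have "(\<Sum>j<r. (c(i := - 1)) j * D (b j)) = 0" by simp
  moreover have "(c(i := - 1)) j \<in> adjoin L (b ` {..<r})" if "j < r" for j
    using c(1) sub that by (auto intro: subfield_closed adjoin_subfield)
  ultimately have "(c(i := - 1)) i = 0" using indep[of "c(i := - 1)" i] i by blast
  then show False by simp
qed

text \<open>The derivative of \<open>h(b i)\<close> is \<open>h'(b i) D (b i)\<close> plus the contribution of the coefficients, and
  the latter is a combination of the \<open>D (b j)\<close> with \<open>j < i\<close>. Independence separates the two.\<close>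

lemma derivation_constant_pderiv:
  assumes i: "i < r" and h: "h \<in> polys_over (adjoin L (b ` {..<i}))" and 0: "D (poly h (b i)) = 0"
  shows "poly (pderiv h) (b i) = 0"
proof -
  define E where "E = adjoin L (b ` {..<r})"
  have E: "subfield E ambient" unfolding E_def by (rule adjoin_subfield)
  have sub: "adjoin L (b ` {..<i}) \<subseteq> E" unfolding E_def using i by (intro adjoin_mono) auto
  have "E \<subseteq> M" unfolding E_def using const gens by (intro adjoin_least M) auto
  have hE: "h \<in> polys_over E" using h sub by (auto simp: polys_over_def)
  have hM: "h \<in> polys_over M" using hE \<open>E \<subseteq> M\<close> by (auto simp: polys_over_def)
  have biE: "b i \<in> E" using adjoin_generator[of "b ` {..<r}" L] i unfolding E_def by auto
  have biM: "b i \<in> M" using gens i by auto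
  have "\<exists>c. (\<forall>j\<in>{..<i}. c j \<in> adjoin L (b ` {..<i})) \<and>
      D (poly.coeff h n) = (\<Sum>j\<in>{..<i}. c j * D (b j))" for n
    by (rule derivation_adjoin_span[OF D M const]) (use gens i h in \<open>auto simp: polys_over_def\<close>)
  from choice[OF allI[OF this]] obtain c where c': "\<forall>n. (\<forall>j\<in>{..<i}. c n j \<in> adjoin L (b ` {..<i})) \<and>
      D (poly.coeff h n) = (\<Sum>j\<in>{..<i}. c n j * D (b j))" ..
  have c: "\<And>n j. j < i \<Longrightarrow> c n j \<in> E" "\<And>n. D (poly.coeff h n) = (\<Sum>j<i. c n j * D (b j))"
    using c' sub by auto
  define C where "C j = (if j < i then (\<Sum>n\<le>Polynomial.degree h. c n j * b i ^ n)
    else if j = i then poly (pderiv h) (b i) else 0)" for j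
  have D0: "D 0 = 0" by (rule derivation_0[OF D M])
  have "Polynomial.degree (map_poly D h) \<le> Polynomial.degree h"
    by (rule degree_le) (simp add: coeff_map_poly D0 coeff_eq_0)
  then have "poly (map_poly D h) (b i) =
      (\<Sum>n\<le>Polynomial.degree h. poly.coeff (map_poly D h) n * b i ^ n)"
    unfolding poly_altdef by (intro sum.mono_neutral_left) (auto simp: not_le coeff_eq_0)
  also have "\<dots> = (\<Sum>n\<le>Polynomial.degree h. D (poly.coeff h n) * b i ^ n)"
    by (simp add: coeff_map_poly D0)
  also have "\<dots> = (\<Sum>n\<le>Polynomial.degree h. \<Sum>j<i. c n j * b i ^ n * D (b j))"
    unfolding c(2) sum_distrib_right by (simp add: mult_ac)
  also have "\<dots> = (\<Sum>j<i. C j * D (b j))"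
    unfolding C_def by (subst sum.swap) (simp add: sum_distrib_right)
  finally have "D (poly h (b i)) = (\<Sum>j<i. C j * D (b j)) + C i * D (b i)"
    unfolding derivation_poly[OF D M hM biM] by (simp add: C_def)
  also have "\<dots> = (\<Sum>j\<in>{..<Suc i}. C j * D (b j))" by simp
  also have "\<dots> = (\<Sum>j<r. C j * D (b j))"
    using i by (intro sum.mono_neutral_left) (auto simp: C_def)
  finally have "(\<Sum>j<r. C j * D (b j)) = 0" using 0 by simp
  moreover have "C j \<in> adjoin L (b ` {..<r})" if "j < r" for j
  proof -
    have "poly (pderiv h) (b i) \<in> E"
      by (rule poly_closed[OF E polys_over_pderiv[OF E hE] biE])
    moreover have "(\<Sum>n\<le>Polynomial.degree h. c n j * b i ^ n) \<in> E" if "j < i"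
      using c(1)[OF that] biE by (intro subfield_sum[OF E] subfield_mult[OF E] subfield_power[OF E])
    ultimately show ?thesis
      unfolding E_def[symmetric] C_def using subfield_0[OF E] by simp
  qed
  ultimately have "C i = 0" using indep[of C i] i by blast
  then show ?thesis by (simp add: C_def)
qed

text \<open>If \<open>h\<close> vanishes at \<open>b i\<close>, so does its formal derivative, which has smaller degree; below
  degree \<open>p\<close> only constants have derivative zero. So \<open>b i\<close> has degree \<open>p\<close> over the field generated
  by its predecessors.\<close>

lemma p_independent_low_degree:
  assumes i: "i < r"
  shows "h \<in> polys_over (adjoin L (b ` {..<i})) \<Longrightarrow> Polynomial.degree h < CHAR('a) \<Longrightarrow>
    poly h (b i) = 0 \<Longrightarrow> h = 0"
proof (induction "Polynomial.degree h" arbitrary: h rule: less_induct)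
  case less
  have z: "poly (pderiv h) (b i) = 0"
    by (rule derivation_constant_pderiv[OF i less.prems(1)])
       (simp add: less.prems(3) derivation_0[OF D M])
  have "Polynomial.degree h = 0"
  proof (rule ccontr)
    assume n: "Polynomial.degree h \<noteq> 0"
    have d: "Polynomial.degree (pderiv h) < Polynomial.degree h"
      using n degree_pderiv_le[of h] by linarith
    have "pderiv h = 0"
      using less.prems(2) d z
      by (intro less.hyps[OF d] polys_over_pderiv[OF adjoin_subfield less.prems(1)]) simp_all
    from pderiv_0_low_degree[OF this less.prems(2)] n show False by simp
  qed
  then obtain a where "h = [:a:]" by (rule degree_eq_zeroE)
  then show "h = 0" using less.prems(3) by simp
qed

text \<open>A constant of \<open>D\<close> in \<open>L(b 0, ..., b i)\<close> is a polynomial of degree below \<open>p\<close> in \<open>b i\<close> over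
  \<open>L(b 0, ..., b (i - 1))\<close> whose formal derivative vanishes at \<open>b i\<close>; hence it does not involve
  \<open>b i\<close>. Removing the generators one after the other leaves \<open>L\<close>.\<close>

lemma derivation_constants:
  assumes "i \<le> r" "u \<in> adjoin L (b ` {..<i})" "D u = 0"
  shows "u \<in> L"
  using assms
proof (induction i)
  case 0
  then show ?case using adjoin_absorb[OF L, of "{}"] by simp
next
  case (Suc i)
  let ?E = "adjoin L (b ` {..<i})"
  have i: "i < r" using Suc.prems by simp
  have "b ` {..<Suc i} = insert (b i) (b ` {..<i})" by (simp add: lessThan_Suc)
  then have "b ` {..<Suc i} \<subseteq> adjoin ?E {b i}"
    using order_trans[OF adjoin_generator adjoin_base] adjoin_generator[of "{b i}" ?E] by simp
  then have "adjoin L (b ` {..<Suc i}) \<subseteq> adjoin ?E {b i}"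
    using order_trans[OF adjoin_base adjoin_base] by (intro adjoin_least[OF adjoin_subfield])
  moreover have "b i ^ CHAR('a) \<in> ?E" using roots[OF i] adjoin_base[of L] by auto
  ultimately obtain g where g: "g \<in> polys_over ?E" "Polynomial.degree g < CHAR('a)" "u = poly g (b i)"
    using adjoin_p_root_poly[OF char adjoin_subfield] Suc.prems(2) by blast
  have z: "poly (pderiv g) (b i) = 0"
    using derivation_constant_pderiv[OF i g(1)] Suc.prems(3) g(3) by simp
  have "Polynomial.degree (pderiv g) < CHAR('a)"
    using g(2) degree_pderiv_le[of g] by linarith
  then have "pderiv g = 0"
    by (rule p_independent_low_degree[OF i polys_over_pderiv[OF adjoin_subfield g(1)] _ z])
  then have "Polynomial.degree g = 0" by (rule pderiv_0_low_degree) (rule g(2))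
  then obtain a where "g = [:a:]" by (auto elim: degree_eq_zeroE)
  then have "u \<in> ?E" using g(1,3) by (auto simp: polys_over_def dest!: spec[of _ 0])
  with Suc show ?case by simp
qed

end

section \<open>Transcendence of the indeterminates\<close>

subsection \<open>Evaluation of polynomials\<close>

definition monomial_eval :: "('i \<Rightarrow> 'a::field) \<Rightarrow> ('i \<Rightarrow>\<^sub>0 nat) \<Rightarrow> 'a" where
  "monomial_eval x m = (\<Prod>i\<in>Poly_Mapping.keys m. x i ^ Poly_Mapping.lookup m i)"

lemma monomial_eval_superset:
  assumes "finite S" "Poly_Mapping.keys m \<subseteq> S"
  shows "monomial_eval x m = (\<Prod>i\<in>S. x i ^ Poly_Mapping.lookup m i)"
  unfolding monomial_eval_def
  by (rule prod.mono_neutral_left) (use assms in \<open>auto simp: in_keys_iff\<close>)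

lemma monomial_eval_add: "monomial_eval x (m + n) = monomial_eval x m * monomial_eval x n"
proof -
  let ?S = "Poly_Mapping.keys m \<union> Poly_Mapping.keys n"
  have "Poly_Mapping.keys (m + n) \<subseteq> ?S" by (rule keys_add)
  then show ?thesis
    by (simp add: monomial_eval_superset[of ?S] lookup_add power_add prod.distrib)
qed

lemma monomial_eval_single: "monomial_eval x (Poly_Mapping.single i n) = x i ^ n"
  by (simp add: monomial_eval_superset[of "{i}"])

lemma monomial_eval_0: "monomial_eval x 0 = 1"
  by (simp add: monomial_eval_def)

lemma mpoly_eval_superset:
  assumes "finite S" "Poly_Mapping.keys P \<subseteq> S"
  shows "mpoly_eval x P = (\<Sum>m\<in>S. Poly_Mapping.lookup P m * monomial_eval x m)"
  unfolding mpoly_eval_def monomial_eval_def[symmetric]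
  by (rule sum.mono_neutral_left) (use assms in \<open>auto simp: in_keys_iff\<close>)

lemma mpoly_eval_add: "mpoly_eval x (P + R) = mpoly_eval x P + mpoly_eval x R"
proof -
  let ?S = "Poly_Mapping.keys P \<union> Poly_Mapping.keys R"
  have "Poly_Mapping.keys (P + R) \<subseteq> ?S" by (rule keys_add)
  then show ?thesis
    by (simp add: mpoly_eval_superset[of ?S] lookup_add distrib_right sum.distrib)
qed

lemma mpoly_eval_0: "mpoly_eval x 0 = 0"
  by (simp add: mpoly_eval_def)

lemma mpoly_eval_sum: "mpoly_eval x (sum P A) = (\<Sum>i\<in>A. mpoly_eval x (P i))"
  by (induction A rule: infinite_finite_induct) (auto simp: mpoly_eval_0 mpoly_eval_add)

lemma mpoly_eval_single: "mpoly_eval x (Poly_Mapping.single m c) = c * monomial_eval x m"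
  by (simp add: mpoly_eval_superset[of "{m}"])

lemma poly_mapping_sum_single:
  "P = (\<Sum>m\<in>Poly_Mapping.keys P. Poly_Mapping.single m (Poly_Mapping.lookup P m))"
  by (rule poly_mapping_eqI) (auto simp: lookup_sum lookup_single when_def in_keys_iff)

lemma poly_mapping_mult_single:
  fixes P R :: "('i \<Rightarrow>\<^sub>0 nat) \<Rightarrow>\<^sub>0 'a::field"
  shows "P * R = (\<Sum>m\<in>Poly_Mapping.keys P. \<Sum>n\<in>Poly_Mapping.keys R.
    Poly_Mapping.single (m + n) (Poly_Mapping.lookup P m * Poly_Mapping.lookup R n))"
  by (subst (1) poly_mapping_sum_single[of P], subst (1) poly_mapping_sum_single[of R])
     (simp only: sum_product mult_single)

lemma mpoly_eval_mult: "mpoly_eval x (P * R) = mpoly_eval x P * mpoly_eval x R"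
proof -
  have "mpoly_eval x (P * R) = (\<Sum>m\<in>Poly_Mapping.keys P. \<Sum>n\<in>Poly_Mapping.keys R.
    (Poly_Mapping.lookup P m * monomial_eval x m) * (Poly_Mapping.lookup R n * monomial_eval x n))"
    unfolding poly_mapping_mult_single mpoly_eval_sum mpoly_eval_single monomial_eval_add
    by (simp add: mult_ac)
  also have "\<dots> = mpoly_eval x P * mpoly_eval x R"
    unfolding mpoly_eval_def monomial_eval_def[symmetric] by (simp add: sum_product)
  finally show ?thesis .
qed

definition mpolys_over :: "'a::field set \<Rightarrow> 'i set \<Rightarrow> (('i \<Rightarrow>\<^sub>0 nat) \<Rightarrow>\<^sub>0 'a) set" where
  "mpolys_over Q I = {P. range (Poly_Mapping.lookup P) \<subseteq> Q \<and>
     (\<forall>m\<in>Poly_Mapping.keys P. Poly_Mapping.keys m \<subseteq> I)}"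

lemma mpolys_overD:
  assumes "P \<in> mpolys_over Q I"
  shows "Poly_Mapping.lookup P m \<in> Q" "m \<in> Poly_Mapping.keys P \<Longrightarrow> Poly_Mapping.keys m \<subseteq> I"
  using assms unfolding mpolys_over_def by blast+

context
  fixes Q :: "'a::field set" and I :: "'i set"
  assumes Q: "subfield Q ambient"
begin

lemma mpolys_over_0: "0 \<in> mpolys_over Q I"
  using subfield_0[OF Q] by (auto simp: mpolys_over_def)

lemma mpolys_over_single:
  "c \<in> Q \<Longrightarrow> Poly_Mapping.keys m \<subseteq> I \<Longrightarrow> Poly_Mapping.single m c \<in> mpolys_over Q I"
  using subfield_0[OF Q] by (auto simp: mpolys_over_def lookup_single when_def)

lemma mpolys_over_add: "P \<in> mpolys_over Q I \<Longrightarrow> R \<in> mpolys_over Q I \<Longrightarrow> P + R \<in> mpolys_over Q I"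
  using keys_add[of P R] subfield_add[OF Q]
  unfolding mpolys_over_def by (auto simp: lookup_add image_subset_iff dest!: subsetD)

lemma mpolys_over_sum: "(\<And>i. i \<in> A \<Longrightarrow> P i \<in> mpolys_over Q I) \<Longrightarrow> sum P A \<in> mpolys_over Q I"
  by (induction A rule: infinite_finite_induct) (auto intro: mpolys_over_0 mpolys_over_add)

lemma mpolys_over_mult:
  assumes "P \<in> mpolys_over Q I" "R \<in> mpolys_over Q I"
  shows "P * R \<in> mpolys_over Q I"
  unfolding poly_mapping_mult_single[of P R]
proof (intro mpolys_over_sum mpolys_over_single)
  fix m n assume m: "m \<in> Poly_Mapping.keys P" and n: "n \<in> Poly_Mapping.keys R"
  show "Poly_Mapping.lookup P m * Poly_Mapping.lookup R n \<in> Q"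
    by (intro subfield_mult[OF Q] mpolys_overD(1)[OF assms(1)] mpolys_overD(1)[OF assms(2)])
  show "Poly_Mapping.keys (m + n) \<subseteq> I"
    using keys_add[of m n] mpolys_overD(2)[OF assms(1) m] mpolys_overD(2)[OF assms(2) n] by blast
qed

end

definition mpoly_values :: "'a::field set \<Rightarrow> 'i set \<Rightarrow> ('i \<Rightarrow> 'a) \<Rightarrow> 'a set" where
  "mpoly_values Q I x = mpoly_eval x ` mpolys_over Q I"

context
  fixes Q :: "'a::field set" and I :: "'i set" and x :: "'i \<Rightarrow> 'a"
  assumes Q: "subfield Q ambient"
begin

lemma mpoly_values_add: "a \<in> mpoly_values Q I x \<Longrightarrow> b \<in> mpoly_values Q I x \<Longrightarrow> a + b \<in> mpoly_values Q I x"
  and mpoly_values_mult: "a \<in> mpoly_values Q I x \<Longrightarrow> b \<in> mpoly_values Q I x \<Longrightarrow> a * b \<in> mpoly_values Q I x"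
  unfolding mpoly_values_def
  by (auto simp flip: mpoly_eval_add mpoly_eval_mult intro!: imageI mpolys_over_add mpolys_over_mult Q)

lemma mpoly_values_base: "c \<in> Q \<Longrightarrow> c \<in> mpoly_values Q I x"
  unfolding mpoly_values_def
  by (rule image_eqI[of _ _ "Poly_Mapping.single 0 c"])
     (auto simp: mpoly_eval_single monomial_eval_0 intro: mpolys_over_single Q)

lemma mpoly_values_var: "i \<in> I \<Longrightarrow> x i \<in> mpoly_values Q I x"
  unfolding mpoly_values_def
  by (rule image_eqI[of _ _ "Poly_Mapping.single (Poly_Mapping.single i 1) 1"])
     (auto simp: mpoly_eval_single monomial_eval_single
        intro!: mpolys_over_single[OF Q] subfield_1[OF Q])

lemma mpoly_values_uminus: "a \<in> mpoly_values Q I x \<Longrightarrow> - a \<in> mpoly_values Q I x"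
  using mpoly_values_mult[OF mpoly_values_base[of "-1"], of a] subfield_uminus[OF Q subfield_1[OF Q]] by simp

lemma adjoin_mpoly_fractions:
  assumes "u \<in> adjoin Q (x ` I)"
  shows "\<exists>a\<in>mpoly_values Q I x. \<exists>b\<in>mpoly_values Q I x. b \<noteq> 0 \<and> u = a / b"
  by (rule adjoin_fractions[OF _ _ _ _ _ assms])
     (use mpoly_values_base subfield_1[OF Q] in
       \<open>auto intro: mpoly_values_add mpoly_values_mult mpoly_values_uminus mpoly_values_var\<close>)

lemma mpoly_common_denominator:
  assumes "finite A" "A \<subseteq> adjoin Q (x ` I)"
  shows "\<exists>b\<in>mpoly_values Q I x. b \<noteq> 0 \<and> (\<forall>u\<in>A. b * u \<in> mpoly_values Q I x)"
  using assms
proof (induction A rule: finite_induct)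
  case empty
  then show ?case using mpoly_values_base[OF subfield_1[OF Q]] by (auto intro!: bexI[of _ 1])
next
  case (insert u A)
  then obtain b where b: "b \<in> mpoly_values Q I x" "b \<noteq> 0" "\<forall>u\<in>A. b * u \<in> mpoly_values Q I x" by auto
  obtain c d where u: "c \<in> mpoly_values Q I x" "d \<in> mpoly_values Q I x" "d \<noteq> 0" "u = c / d"
    using adjoin_mpoly_fractions[of u] insert.prems by auto
  have "d * b * w \<in> mpoly_values Q I x" if "w \<in> insert u A" for w
  proof (cases "w = u")
    case True
    then have "d * b * w = b * c" using u by simp
    then show ?thesis using mpoly_values_mult[OF b(1) u(1)] by (simp only:)
  next
    case False
    then show ?thesis using mpoly_values_mult[of d "b * w"] b u that by (simp add: mult.assoc)
  qed
  then show ?case using b u mpoly_values_mult[of d b] by (intro bexI[of _ "d * b"]) auto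
qed

end

text \<open>Clearing denominators turns an algebraic equation for one indeterminate over the field generated
  by the others into a polynomial relation between all of them.\<close>

lemma alg_independent_transcendental:
  fixes Q :: "'a::field set" and x :: "'i \<Rightarrow> 'a"
  assumes Q: "subfield Q ambient" and ind: "alg_independent Q I x" and v: "v \<in> I"
  shows "transcendental_over (adjoin Q (x ` (I - {v}))) (x v)"
  unfolding transcendental_over_def
proof (intro ballI impI)
  let ?J = "I - {v}"
  fix h assume h: "h \<in> polys_over (adjoin Q (x ` ?J))" and 0: "poly h (x v) = 0"
  let ?d = "Polynomial.degree h"
  have "poly.coeff h ` {..?d} \<subseteq> adjoin Q (x ` ?J)" using h by (auto simp: polys_over_def)
  from mpoly_common_denominator[OF Q _ this]
  obtain b where b: "b \<noteq> 0" "\<And>i. i \<le> ?d \<Longrightarrow> b * poly.coeff h i \<in> mpoly_values Q ?J x" by auto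
  then have "\<exists>P. i \<le> ?d \<longrightarrow> P \<in> mpolys_over Q ?J \<and> b * poly.coeff h i = mpoly_eval x P" for i
    unfolding mpoly_values_def by blast
  then obtain P where P: "\<And>i. i \<le> ?d \<Longrightarrow> P i \<in> mpolys_over Q ?J"
    "\<And>i. i \<le> ?d \<Longrightarrow> b * poly.coeff h i = mpoly_eval x (P i)" by metis
  let ?s = "\<lambda>i. Poly_Mapping.single v i :: 'i \<Rightarrow>\<^sub>0 nat"
  define R where "R = (\<Sum>i\<le>?d. P i * Poly_Mapping.single (?s i) 1)"
  have "R \<in> mpolys_over Q I"
    unfolding R_def
  proof (intro mpolys_over_sum mpolys_over_mult Q)
    fix i assume "i \<in> {..?d}"
    then show "P i \<in> mpolys_over Q I" using P(1)[of i] by (auto simp: mpolys_over_def)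
    show "Poly_Mapping.single (?s i) 1 \<in> mpolys_over Q I"
      using v by (intro mpolys_over_single Q subfield_1) auto
  qed
  moreover have "mpoly_eval x R = b * poly h (x v)"
    unfolding R_def mpoly_eval_sum mpoly_eval_mult mpoly_eval_single monomial_eval_single poly_altdef
    by (simp add: sum_distrib_left P(2) flip: mult.assoc)
  ultimately have R: "R = 0" using ind 0 unfolding alg_independent_def mpolys_over_def by auto
  \<comment> \<open>No monomial of \<open>P i\<close> involves \<open>v\<close>, so the exponent of \<open>v\<close> in a monomial of \<open>R\<close> tells
    from which summand it comes.\<close>
  have "P i = 0" if i: "i \<le> ?d" for i
  proof (rule ccontr)
    assume "P i \<noteq> 0"
    then obtain m where m: "m \<in> Poly_Mapping.keys (P i)" by (metis all_not_in_conv keys_eq_empty)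
    have no_v: "Poly_Mapping.lookup n v = 0" if "j \<le> ?d" "n \<in> Poly_Mapping.keys (P j)" for j n
    proof -
      have "v \<notin> Poly_Mapping.keys n" using mpolys_overD(2)[OF P(1)[OF that(1)] that(2)] by blast
      then show ?thesis by (simp add: in_keys_iff)
    qed
    have eq: "n + ?s j = m + ?s i \<longleftrightarrow> n = m \<and> j = i"
      if "j \<le> ?d" "n \<in> Poly_Mapping.keys (P j)" for j n
    proof
      assume e: "n + ?s j = m + ?s i"
      have "j = i"
        using arg_cong[OF e, of "\<lambda>k. Poly_Mapping.lookup k v"] no_v[OF that] no_v[OF i m]
        by (simp add: lookup_add)
      with e show "n = m \<and> j = i" by simp
    qed simp
    have "Poly_Mapping.lookup R (m + ?s i) = (\<Sum>j\<le>?d. \<Sum>n\<in>Poly_Mapping.keys (P j).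
        if n = m \<and> j = i then Poly_Mapping.lookup (P j) n else 0)"
      unfolding R_def poly_mapping_mult_single lookup_sum
      by (intro sum.cong refl) (auto simp: lookup_single eq when_def)
    also have "\<dots> = (\<Sum>j\<le>?d. if j = i then Poly_Mapping.lookup (P j) m else 0)"
      using m by (intro sum.cong refl) (auto simp: if_distrib cong: if_cong)
    also have "\<dots> = Poly_Mapping.lookup (P i) m" using i by simp
    finally show False using R m by (simp add: in_keys_iff)
  qed
  then have "poly.coeff h i = 0" if "i \<le> ?d" for i
    using P(2)[OF that] b(1) that by (simp add: mpoly_eval_0)
  then show "h = 0" by (metis leading_coeff_0_iff order_refl)
qed

text \<open>Raising an equation for \<open>t\<close> to a high power of \<open>p\<close> moves its coefficients into \<open>K\<close> and
  replaces \<open>t\<close> by a power of \<open>s\<close>.\<close>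

lemma transcendental_over_perfect_closure:
  assumes char: "CHAR('a::field) > 0" and K: "subfield K (ambient :: 'a ring)"
    and s: "transcendental_over K s" and t: "t ^ CHAR('a) ^ m = s"
  shows "transcendental_over (perfect_closure K) t"
  unfolding transcendental_over_def
proof (intro ballI impI)
  let ?p = "CHAR('a)"
  fix f assume f: "f \<in> polys_over (perfect_closure K)" and 0: "poly f t = 0"
  let ?d = "Polynomial.degree f"
  have "\<forall>i. \<exists>n. poly.coeff f i ^ ?p ^ n \<in> K"
    using f by (auto simp: polys_over_def perfect_closure_def)
  then obtain n where n: "\<And>i. poly.coeff f i ^ ?p ^ n i \<in> K" by metis
  define N where "N = m + (\<Sum>i\<le>?d. n i)"
  have c: "poly.coeff f i ^ ?p ^ N \<in> K" if "i \<le> ?d" for i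
  proof (rule perfect_closure_level[OF K n[of i]])
    show "n i \<le> N" unfolding N_def using that member_le_sum[of i "{..?d}" n] by simp
  qed
  define e where "e = ?p ^ (N - m)"
  have e: "e > 0" unfolding e_def using char by simp
  have te: "t ^ ?p ^ N = s ^ e"
    unfolding t[symmetric] e_def N_def by (simp flip: power_mult power_add)
  define h where "h = (\<Sum>i\<le>?d. Polynomial.monom (poly.coeff f i ^ ?p ^ N) (i * e))"
  have "h \<in> polys_over K"
    unfolding h_def polys_over_def using c by (auto simp: coeff_sum intro!: subfield_closed[OF K])
  moreover have "poly h s = poly f t ^ ?p ^ N"
  proof -
    have "poly f t ^ ?p ^ N = (\<Sum>i\<le>?d. (poly.coeff f i * t ^ i) ^ ?p ^ N)"
      unfolding poly_altdef by (rule frob_sum[OF char])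
    also have "\<dots> = (\<Sum>i\<le>?d. poly.coeff f i ^ ?p ^ N * (t ^ ?p ^ N) ^ i)"
      by (simp add: power_mult_distrib mult.commute flip: power_mult)
    also have "\<dots> = poly h s"
      unfolding te h_def poly_sum poly_monom by (simp add: mult.commute flip: power_mult)
    finally show ?thesis by simp
  qed
  ultimately have h: "h = 0" using s 0 char unfolding transcendental_over_def by simp
  have "poly.coeff f i = 0" if "i \<le> ?d" for i
  proof -
    have "poly.coeff h (i * e) = (\<Sum>j\<le>?d. if j = i then poly.coeff f j ^ ?p ^ N else 0)"
      unfolding h_def coeff_sum using e by (intro sum.cong) auto
    then show ?thesis using that h by simp
  qed
  then show "f = 0" by (metis leading_coeff_0_iff order_refl)
qed

section \<open>The tower of purely inseparable extensions\<close>

locale inseparable_tower =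
  fixes Q :: "'a::field set" and x :: 'a and y z :: "nat \<Rightarrow> 'a"
  assumes char: "CHAR('a) > 0"
    and Q: "subfield Q ambient"
    and indep: "alg_independent Q indets (indet_val x y z)"
    and closure: "algebraic_closure ambient (base_field Q x y z)"
begin

abbreviation "k \<equiv> base_field Q x y z"
abbreviation "stage \<equiv> ext_stage Q x y z"
abbreviation "\<alpha> \<equiv> alpha x y z"

text \<open>The field of constants for the derivative with respect to the indeterminate \<open>v\<close>. It is closed under
  \<open>p\<close>-power roots, hence contains all roots of the other indeterminates, but no root of \<open>v\<close> is
  algebraic over it.\<close>

definition coeff_field :: "indet \<Rightarrow> 'a set" where
  "coeff_field v = perfect_closure (adjoin Q (indet_val x y z ` (indets - {v})))"

lemma indets: "Ind_X \<in> indets" "i \<ge> 1 \<Longrightarrow> Ind_Y i \<in> indets" "i \<ge> 1 \<Longrightarrow> Ind_Z i \<in> indets"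
  by (auto simp: indets_def)

lemma coeff_field_subfield: "subfield (coeff_field v) ambient"
  unfolding coeff_field_def by (rule subfield_perfect_closure[OF char adjoin_subfield])

lemma coeff_field_proot: "a \<in> coeff_field v \<Longrightarrow> proot n a \<in> coeff_field v"
  unfolding coeff_field_def by (rule perfect_closure_root[of _ n]) (simp add: proot_power[OF char closure])

lemma coeff_field_base: "Q \<subseteq> coeff_field v"
  unfolding coeff_field_def by (intro subsetI perfect_closureI adjoin_baseI)

lemma coeff_field_var:
  assumes "w \<in> indets" "w \<noteq> v"
  shows "indet_val x y z w \<in> coeff_field v"
  unfolding coeff_field_def using assms
  by (intro perfect_closureI adjoin_generatorI imageI) simp

lemma coeff_field_x: "v \<noteq> Ind_X \<Longrightarrow> x \<in> coeff_field v"
  and coeff_field_y: "i \<ge> 1 \<Longrightarrow> v \<noteq> Ind_Y i \<Longrightarrow> y i \<in> coeff_field v"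
  and coeff_field_z: "i \<ge> 1 \<Longrightarrow> v \<noteq> Ind_Z i \<Longrightarrow> z i \<in> coeff_field v"
  using coeff_field_var[of Ind_X v] coeff_field_var[of "Ind_Y i" v] coeff_field_var[of "Ind_Z i" v] indets by auto

lemma partial_derivative:
  assumes "v \<in> indets" and t: "t = proot m (indet_val x y z v)"
  obtains D where "derivation_on (adjoin (coeff_field v) {t}) D" "\<And>a. a \<in> coeff_field v \<Longrightarrow> D a = 0" "D t = 1"
proof -
  have "transcendental_over (coeff_field v) t"
    unfolding coeff_field_def t
    using transcendental_over_perfect_closure[OF char adjoin_subfield
        alg_independent_transcendental[OF Q indep assms(1)] proot_power[OF char closure]] .
  then show thesis using transcendental_derivation[OF coeff_field_subfield] that by blast
qed

lemma base_field_least: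
  assumes "subfield E ambient" "Q \<subseteq> E" "x \<in> E" "\<And>i. i \<ge> 1 \<Longrightarrow> y i \<in> E" "\<And>i. i \<ge> 1 \<Longrightarrow> z i \<in> E"
  shows "k \<subseteq> E"
  unfolding base_field_def indets_def using assms by (intro adjoin_least) auto

lemma stage_least:
  assumes "subfield E ambient" "k \<subseteq> E" "proot m x \<in> E"
    "\<And>j. 1 \<le> j \<Longrightarrow> j < m \<Longrightarrow> \<alpha> m j \<in> E"
  shows "stage m \<subseteq> E"
  unfolding ext_stage_def using assms by (intro adjoin_least) auto

lemma base_field_subfield: "subfield k ambient"
  unfolding base_field_def by (rule adjoin_subfield)

lemma base_field_x: "x \<in> k"
  and base_field_y: "i \<ge> 1 \<Longrightarrow> y i \<in> k"
  and base_field_z: "i \<ge> 1 \<Longrightarrow> z i \<in> k"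
proof -
  have "indet_val x y z w \<in> k" if "w \<in> indets" for w
    unfolding base_field_def using that by (intro adjoin_generatorI imageI)
  from this[of Ind_X] this[of "Ind_Y i"] this[of "Ind_Z i"]
  show "x \<in> k" "i \<ge> 1 \<Longrightarrow> y i \<in> k" "i \<ge> 1 \<Longrightarrow> z i \<in> k" using indets by auto
qed

lemma stage_subfield: "subfield (stage m) ambient"
  unfolding ext_stage_def by (rule adjoin_subfield)

lemma stage_base: "k \<subseteq> stage m"
  unfolding ext_stage_def by (rule adjoin_base)

lemma stage_x: "proot m x \<in> stage m"
  and stage_alpha: "1 \<le> j \<Longrightarrow> j < m \<Longrightarrow> \<alpha> m j \<in> stage m"
  unfolding ext_stage_def
  using adjoin_generator[of "{proot m x} \<union> \<alpha> m ` {1..m - 1}" k] by auto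

lemma proot_0: "proot 0 a = (a :: 'a)"
  by (rule proot_unique[OF char]) simp

lemma proot_frob: "e \<le> m \<Longrightarrow> proot m (a :: 'a) ^ CHAR('a) ^ e = proot (m - e) a"
  by (rule proot_unique[OF char, symmetric])
     (simp add: proot_power[OF char closure] flip: power_mult power_add)

text \<open>The elements \<open>\<alpha> m j\<close> with \<open>j\<close> fixed form a chain of \<open>p\<close>-th roots. It starts with
  \<open>\<alpha> j j = z j * proot j x + y j\<close>, which already lies in \<open>k(proot j x)\<close>.\<close>

lemma alpha_frob:
  assumes "j + e \<le> m"
  shows "\<alpha> m j ^ CHAR('a) ^ e = \<alpha> (m - e) j"
proof -
  have "m - j - e = m - e - j" using assms by simp
  then show ?thesis
    using assms unfolding alpha_def frob_add[OF char] power_mult_distrib by (simp add: proot_frob)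
qed

lemma alpha_diag: "\<alpha> j j = z j * proot j x + y j"
  by (simp add: alpha_def proot_0)

lemma stage_alpha_diag:
  assumes "1 \<le> j" "j \<le> m"
  shows "\<alpha> m j \<in> stage m"
proof (cases "j = m")
  case True
  then show ?thesis
    using assms stage_x[of m] stage_base[of m] base_field_y[of m] base_field_z[of m]
    unfolding True alpha_diag
    by (intro subfield_add[OF stage_subfield] subfield_mult[OF stage_subfield]) auto
qed (use assms stage_alpha in auto)

lemma stage_exponent:
  assumes "u \<in> stage m"
  shows "u ^ CHAR('a) ^ m \<in> k"
proof -
  have "stage m \<subseteq> {u. u ^ CHAR('a) ^ m \<in> k}"
  proof (rule stage_least[OF subfield_frob_preimage[OF char base_field_subfield]])
    show "k \<subseteq> {u. u ^ CHAR('a) ^ m \<in> k}" using subfield_power[OF base_field_subfield] by blast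
    show "proot m x \<in> {u. u ^ CHAR('a) ^ m \<in> k}" by (simp add: proot_power[OF char closure] base_field_x)
    fix j assume j: "1 \<le> j" "j < m"
    have "\<alpha> m j ^ CHAR('a) ^ m = (\<alpha> m j ^ CHAR('a) ^ (m - j)) ^ CHAR('a) ^ j"
      using j by (simp flip: power_mult power_add)
    also have "\<dots> = z j ^ CHAR('a) ^ j * x + y j ^ CHAR('a) ^ j"
      using j by (simp add: alpha_frob alpha_diag frob_add[OF char] power_mult_distrib
          proot_power[OF char closure])
    finally show "\<alpha> m j \<in> {u. u ^ CHAR('a) ^ m \<in> k}"
      using j base_field_x base_field_y[of j] base_field_z[of j]
      by (auto intro!: subfield_add[OF base_field_subfield] subfield_mult[OF base_field_subfield]
          subfield_power[OF base_field_subfield])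
  qed
  then show ?thesis using assms by blast
qed

text \<open>The generators of \<open>stage m\<close> for \<open>m \<ge> 1\<close> in a single family indexed by \<open>0, ..., m - 1\<close>.\<close>

definition gen :: "nat \<Rightarrow> nat \<Rightarrow> 'a" where
  "gen m j = (if j = 0 then proot m x else \<alpha> m j)"

lemma gen_stage: "j < m \<Longrightarrow> gen m j \<in> stage m"
  by (auto simp: gen_def stage_x stage_alpha)

lemma gen_frob: "j < m \<Longrightarrow> gen m j ^ CHAR('a) \<in> stage (m - 1)"
  using proot_frob[of 1 m x] alpha_frob[of j 1 m] stage_x[of "m - 1"] stage_alpha_diag[of j "m - 1"]
  by (auto simp: gen_def)

lemma stage_Suc: "stage m \<subseteq> stage (Suc m)"
proof (rule stage_least[OF stage_subfield stage_base])
  show "proot m x \<in> stage (Suc m)"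
    using subfield_power[OF stage_subfield stage_x, of "Suc m" "CHAR('a) ^ 1"] proot_frob[of 1 "Suc m" x]
    by simp
  fix j assume "1 \<le> j" "j < m"
  then show "\<alpha> m j \<in> stage (Suc m)"
    using subfield_power[OF stage_subfield stage_alpha, of j "Suc m" "CHAR('a) ^ 1"] alpha_frob[of j 1 "Suc m"]
    by simp
qed

lemma stage_mono: "m \<le> n \<Longrightarrow> stage m \<subseteq> stage n"
  by (rule lift_Suc_mono_le[of stage, OF stage_Suc])

lemma stage_gen:
  assumes "m \<ge> 1" "F \<subseteq> stage m" "k \<subseteq> F"
  shows "adjoin F (gen m ` {..<m}) = stage m"
proof
  show "adjoin F (gen m ` {..<m}) \<subseteq> stage m"
    using assms(2) gen_stage by (intro adjoin_least stage_subfield) auto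
  have g: "gen m j \<in> adjoin F (gen m ` {..<m})" if "j < m" for j
    using that by (intro adjoin_generatorI imageI) simp
  show "stage m \<subseteq> adjoin F (gen m ` {..<m})"
  proof (rule stage_least[OF adjoin_subfield])
    show "k \<subseteq> adjoin F (gen m ` {..<m})" using assms(3) by (auto intro: adjoin_baseI)
    show "proot m x \<in> adjoin F (gen m ` {..<m})" using g[of 0] assms(1) by (simp add: gen_def)
    show "\<alpha> m j \<in> adjoin F (gen m ` {..<m})" if "1 \<le> j" "j < m" for j
      using g[of j] that by (simp add: gen_def)
  qed
qed

subsection \<open>Two kinds of derivations\<close>

text \<open>The derivative with respect to \<open>T = proot m x\<close>. All roots of the \<open>y j\<close> and \<open>z j\<close> are constants,
  and so are the roots of \<open>x\<close> of order \<open>p ^ n\<close> with \<open>n < m\<close>, being \<open>p\<close>-th powers of powers of \<open>T\<close>.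
  Hence all \<open>p ^ n\<close>-th roots of elements of \<open>k\<close> with \<open>n < m\<close> are constants, while
  \<open>\<alpha> m j = proot (m - j) (z j) * T + proot (m - j) (y j)\<close> has the derivative \<open>proot (m - j) (z j)\<close>.\<close>

lemma derivation_x:
  assumes m: "m \<ge> 1"
  obtains M D where "derivation_on M D" "subfield M ambient" "stage (m - 1) \<subseteq> {a \<in> M. D a = 0}"
    "gen m ` {..<m} \<subseteq> M" "D (gen m 0) = 1"
    "\<And>j. 1 \<le> j \<Longrightarrow> j < m \<Longrightarrow> D (gen m j) = proot (m - j) (z j)"
    "\<And>n u. n < m \<Longrightarrow> u ^ CHAR('a) ^ n \<in> k \<Longrightarrow> D u = 0"
proof -
  define T where "T = proot m x"
  define R where "R = coeff_field Ind_X"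
  define M where "M = adjoin R {T}"
  have T: "T = proot m (indet_val x y z Ind_X)" by (simp add: T_def)
  obtain D where D: "derivation_on M D" and DR: "\<And>a. a \<in> R \<Longrightarrow> D a = 0" and DT: "D T = 1"
    using partial_derivative[OF indets(1) T] unfolding M_def R_def by blast
  have M: "subfield M ambient" unfolding M_def by (rule adjoin_subfield)
  have TM: "T \<in> M" and RM: "R \<subseteq> M"
    unfolding M_def by (auto intro: adjoin_generatorI adjoin_baseI)
  define C where "C = {a \<in> M. D a = 0}"
  have C: "subfield C ambient" unfolding C_def by (rule subfield_constants[OF D M])
  have RC: "R \<subseteq> C" using RM DR unfolding C_def by blast
  have yR: "proot n (y j) \<in> R" and zR: "proot n (z j) \<in> R" if "j \<ge> 1" for n j
    using that unfolding R_def by (auto intro!: coeff_field_proot coeff_field_y coeff_field_z)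
  have TC: "proot n x \<in> C" if "n < m" for n
  proof -
    have "proot n x = T ^ CHAR('a) ^ (m - n)" using that proot_frob[of "m - n" m x] by (simp add: T_def)
    then show ?thesis
      using that subfield_power[OF M TM] derivation_frob[OF D M TM, of "m - n"] by (simp add: C_def)
  qed
  have roots: "u \<in> C" if n: "n < m" and u: "u ^ CHAR('a) ^ n \<in> k" for n u
  proof -
    have pow: "a \<in> (\<lambda>a. a ^ CHAR('a) ^ n) ` C" if "proot n a \<in> C" for a
      using that proot_power[OF char closure, of n a] by (metis image_eqI)
    have "k \<subseteq> (\<lambda>a. a ^ CHAR('a) ^ n) ` C"
    proof (rule base_field_least[OF subfield_frob_image[OF char C]])
      show "Q \<subseteq> (\<lambda>a. a ^ CHAR('a) ^ n) ` C"
        using coeff_field_base[of Ind_X] coeff_field_proot[of _ Ind_X n] RC pow unfolding R_def by blast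
      show "x \<in> (\<lambda>a. a ^ CHAR('a) ^ n) ` C" by (rule pow[OF TC[OF n]])
      show "y i \<in> (\<lambda>a. a ^ CHAR('a) ^ n) ` C" "z i \<in> (\<lambda>a. a ^ CHAR('a) ^ n) ` C" if "i \<ge> 1" for i
        using pow yR[OF that] zR[OF that] RC by blast+
    qed
    then obtain a where "a \<in> C" "u ^ CHAR('a) ^ n = a ^ CHAR('a) ^ n" using u by blast
    then show ?thesis by (simp add: frob_inj[OF char])
  qed
  have alphaM: "\<alpha> m j \<in> M" if "j \<ge> 1" for j
    unfolding alpha_def T_def[symmetric] using yR[OF that] zR[OF that] RM TM
    by (intro subfield_add[OF M] subfield_mult[OF M]) auto
  show thesis
  proof (rule that[OF D M])
    show "stage (m - 1) \<subseteq> {a \<in> M. D a = 0}"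
      unfolding C_def[symmetric]
    proof (rule stage_least[OF C])
      show "k \<subseteq> C" using roots[of 0] m by auto
      show T': "proot (m - 1) x \<in> C" using TC[of "m - 1"] m by simp
      show "\<alpha> (m - 1) j \<in> C" if "1 \<le> j" for j
        unfolding alpha_def using T' yR[OF that] zR[OF that] RC
        by (intro subfield_add[OF C] subfield_mult[OF C]) auto
    qed
    show "gen m ` {..<m} \<subseteq> M" using TM alphaM by (auto simp: gen_def T_def)
    show "D (gen m 0) = 1" using DT by (simp add: gen_def T_def)
    show "D (gen m j) = proot (m - j) (z j)" if "1 \<le> j" "j < m" for j
    proof -
      have *: "proot (m - j) (z j) \<in> M" "proot (m - j) (y j) \<in> M"
        "D (proot (m - j) (z j)) = 0" "D (proot (m - j) (y j)) = 0"
        using yR[OF that(1)] zR[OF that(1)] RC unfolding C_def by blast+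
      have "\<alpha> m j = proot (m - j) (z j) * T + proot (m - j) (y j)"
        by (simp add: alpha_def T_def)
      then show ?thesis
        using * that TM by (simp add: gen_def derivation_add[OF D M] derivation_mult[OF D M]
            subfield_mult[OF M] DT)
    qed
    show "D u = 0" if "n < m" "u ^ CHAR('a) ^ n \<in> k" for n u
      using roots[OF that] by (simp add: C_def)
  qed
qed

text \<open>Write \<open>\<zeta> = proot (m - i) (z i)\<close>, \<open>\<eta> = proot (m - i) (y i)\<close> and \<open>T = proot m x\<close>, so that
  \<open>\<alpha> m i = \<zeta> * T + \<eta>\<close>. The derivation is \<open>d/d\<zeta> - T d/d\<eta>\<close>: it moves \<open>\<zeta>\<close> but is built to kill
  \<open>\<alpha> m i\<close>. It kills \<open>z i\<close> and \<open>y i\<close> because these are \<open>p\<close>-th powers; the remaining generators of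
  \<open>stage m\<close> and the roots of the other \<open>z j\<close> do not involve \<open>\<zeta>\<close> or \<open>\<eta>\<close>. The two partial derivatives live on different fields, so it is
  defined on their intersection.\<close>

lemma derivation_z:
  assumes i: "1 \<le> i" "i < m"
  obtains N \<delta> where "derivation_on N \<delta>" "subfield N ambient" "stage m \<subseteq> {a \<in> N. \<delta> a = 0}"
    "\<And>j. 1 \<le> j \<Longrightarrow> j < m \<Longrightarrow> proot (m - j) (z j) \<in> N \<and>
      \<delta> (proot (m - j) (z j)) = (if j = i then 1 else 0)"
proof -
  define T \<zeta> \<eta> where "T = proot m x" and "\<zeta> = proot (m - i) (z i)" and "\<eta> = proot (m - i) (y i)"
  let ?Z = "Ind_Z i" and ?Y = "Ind_Y i"
  define N1 N2 where "N1 = adjoin (coeff_field ?Z) {\<zeta>}" and "N2 = adjoin (coeff_field ?Y) {\<eta>}"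
  have \<zeta>: "\<zeta> = proot (m - i) (indet_val x y z ?Z)" and \<eta>: "\<eta> = proot (m - i) (indet_val x y z ?Y)"
    by (simp_all add: \<zeta>_def \<eta>_def)
  obtain D1 where D1: "derivation_on N1 D1" and D1R: "\<And>a. a \<in> coeff_field ?Z \<Longrightarrow> D1 a = 0" and D1\<zeta>: "D1 \<zeta> = 1"
    using partial_derivative[OF indets(3)[OF i(1)] \<zeta>] unfolding N1_def by blast
  obtain D2 where D2: "derivation_on N2 D2" and D2R: "\<And>a. a \<in> coeff_field ?Y \<Longrightarrow> D2 a = 0" and D2\<eta>: "D2 \<eta> = 1"
    using partial_derivative[OF indets(2)[OF i(1)] \<eta>] unfolding N2_def by blast
  have N1: "subfield N1 ambient" and N2: "subfield N2 ambient"
    unfolding N1_def N2_def by (rule adjoin_subfield)+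
  have sub: "coeff_field ?Z \<subseteq> N1" "coeff_field ?Y \<subseteq> N2" "\<zeta> \<in> N1" "\<eta> \<in> N2"
    unfolding N1_def N2_def by (auto intro: adjoin_generatorI adjoin_baseI)
  define N where "N = N1 \<inter> N2"
  define \<delta> where "\<delta> a = D1 a - T * D2 a" for a
  have N: "subfield N ambient" unfolding N_def by (rule subfield_Int[OF N1 N2])
  have \<delta>: "derivation_on N \<delta>"
    using D1 D2 unfolding derivation_on_def N_def \<delta>_def by (simp add: algebra_simps)
  define C where "C = {a \<in> N. \<delta> a = 0}"
  have C: "subfield C ambient" unfolding C_def by (rule subfield_constants[OF \<delta> N])
  have RC: "a \<in> C" if "a \<in> coeff_field ?Z" "a \<in> coeff_field ?Y" for a
    using that sub D1R D2R unfolding C_def N_def \<delta>_def by auto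
  have xC: "proot n x \<in> C" for n
    by (rule RC) (simp_all add: coeff_field_proot coeff_field_x)
  have yC: "proot n (y j) \<in> C" and zC: "proot n (z j) \<in> C" if "j \<ge> 1" "j \<noteq> i" for n j
    using that by (auto intro!: RC coeff_field_proot coeff_field_y coeff_field_z)
  have \<eta>Z: "\<eta> \<in> coeff_field ?Z" and \<zeta>Y: "\<zeta> \<in> coeff_field ?Y"
    unfolding \<zeta>_def \<eta>_def using i by (auto intro!: coeff_field_proot coeff_field_y coeff_field_z)
  have \<zeta>N: "\<zeta> \<in> N" and \<eta>N: "\<eta> \<in> N" using \<eta>Z \<zeta>Y sub unfolding N_def by auto
  have \<delta>\<zeta>: "\<delta> \<zeta> = 1" and \<delta>\<eta>: "\<delta> \<eta> = - T"
    unfolding \<delta>_def using D1\<zeta> D2\<eta> D1R[OF \<eta>Z] D2R[OF \<zeta>Y] by simp_all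
  have pow: "a ^ CHAR('a) ^ (m - i) \<in> C" if "a \<in> N" for a
    using that i derivation_frob[OF \<delta> N that, of "m - i"] subfield_power[OF N that]
    by (simp add: C_def)
  have TC: "T \<in> C" unfolding T_def by (rule xC)
  have kC: "k \<subseteq> C"
  proof (rule base_field_least[OF C])
    show "Q \<subseteq> C" using coeff_field_base RC by blast
    show "x \<in> C" using xC[of 0] by (simp add: proot_0)
    show "y j \<in> C" if "j \<ge> 1" for j
      using pow[OF \<eta>N] yC[OF that, of 0]
      by (cases "j = i") (simp_all add: \<eta>_def proot_power[OF char closure] proot_0)
    show "z j \<in> C" if "j \<ge> 1" for j
      using pow[OF \<zeta>N] zC[OF that, of 0]
      by (cases "j = i") (simp_all add: \<zeta>_def proot_power[OF char closure] proot_0)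
  qed
  show thesis
  proof (rule that[OF \<delta> N])
    show "stage m \<subseteq> {a \<in> N. \<delta> a = 0}"
      unfolding C_def[symmetric]
    proof (rule stage_least[OF C kC])
      show "proot m x \<in> C" by (rule xC)
      fix j assume j: "1 \<le> j" "j < m"
      show "\<alpha> m j \<in> C"
      proof (cases "j = i")
        case True
        have TN: "T \<in> N" "\<delta> T = 0" using TC by (simp_all add: C_def)
        have "\<delta> (\<zeta> * T + \<eta>) = 0"
          using \<zeta>N \<eta>N TN \<delta>\<zeta> \<delta>\<eta>
          by (simp add: derivation_add[OF \<delta> N] derivation_mult[OF \<delta> N] subfield_mult[OF N])
        then show ?thesis
          using \<zeta>N \<eta>N TN unfolding True alpha_def C_def
          by (simp add: \<zeta>_def \<eta>_def T_def subfield_add[OF N] subfield_mult[OF N])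
      next
        case False
        show ?thesis unfolding alpha_def
          by (intro subfield_add[OF C] subfield_mult[OF C] xC yC zC j False)
      qed
    qed
    show "proot (m - j) (z j) \<in> N \<and> \<delta> (proot (m - j) (z j)) = (if j = i then 1 else 0)"
      if "1 \<le> j" "j < m" for j
      using \<zeta>N \<delta>\<zeta> zC[OF that(1), of "m - j"] by (cases "j = i") (auto simp: \<zeta>_def C_def)
  qed
qed

text \<open>The elements \<open>1\<close> and \<open>proot (m - j) (z j)\<close> are linearly independent over \<open>stage m\<close>: the \<open>i\<close>-th of the
  derivations above, applied to a relation, leaves only the coefficient \<open>c i\<close>.\<close>

lemma roots_z_independent:
  assumes c: "\<And>j. j < m \<Longrightarrow> c j \<in> stage m"
    and sum: "c 0 + (\<Sum>j\<in>{1..<m}. c j * proot (m - j) (z j)) = 0" and i: "i < m"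
  shows "c i = 0"
proof -
  have pos: "c i = 0" if i: "1 \<le> i" "i < m" for i
  proof -
    obtain N \<delta> where \<delta>: "derivation_on N \<delta>" and N: "subfield N ambient"
      and K: "stage m \<subseteq> {a \<in> N. \<delta> a = 0}"
      and \<zeta>: "\<And>j. 1 \<le> j \<Longrightarrow> j < m \<Longrightarrow> proot (m - j) (z j) \<in> N \<and>
        \<delta> (proot (m - j) (z j)) = (if j = i then 1 else 0)"
      using derivation_z[OF i] by blast
    have cN: "c j \<in> N" "\<delta> (c j) = 0" if "j < m" for j using subsetD[OF K c[OF that]] by simp_all
    have summand: "c j * proot (m - j) (z j) \<in> N"
      "\<delta> (c j * proot (m - j) (z j)) = (if j = i then c j else 0)" if "j \<in> {1..<m}" for j
    proof -
      have j: "1 \<le> j" "j < m" using that by simp_all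
      show "c j * proot (m - j) (z j) \<in> N"
        using cN(1)[OF j(2)] \<zeta>[OF j] by (intro subfield_mult[OF N]) simp_all
      show "\<delta> (c j * proot (m - j) (z j)) = (if j = i then c j else 0)"
        using cN[OF j(2)] \<zeta>[OF j] by (simp add: derivation_mult[OF \<delta> N])
    qed
    have c0: "c 0 \<in> N" "\<delta> (c 0) = 0" using cN[of 0] i by simp_all
    have S: "(\<Sum>j\<in>{1..<m}. c j * proot (m - j) (z j)) \<in> N"
      by (rule subfield_sum[OF N summand(1)])
    have "0 = \<delta> (c 0 + (\<Sum>j\<in>{1..<m}. c j * proot (m - j) (z j)))"
      unfolding sum by (simp add: derivation_0[OF \<delta> N])
    also have "\<dots> = \<delta> (\<Sum>j\<in>{1..<m}. c j * proot (m - j) (z j))"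
      using derivation_add[OF \<delta> N c0(1) S] c0(2) by simp
    also have "\<dots> = (\<Sum>j\<in>{1..<m}. \<delta> (c j * proot (m - j) (z j)))"
      by (rule derivation_sum[OF \<delta> N summand(1)])
    also have "\<dots> = (\<Sum>j\<in>{1..<m}. if j = i then c j else 0)"
      by (rule sum.cong[OF refl summand(2)])
    also have "\<dots> = c i" using i by simp
    finally show ?thesis by simp
  qed
  show ?thesis
  proof (cases "i = 0")
    case True
    have "(\<Sum>j\<in>{1..<m}. c j * proot (m - j) (z j)) = 0" by (rule sum.neutral) (use pos in auto)
    then show ?thesis using sum True by simp
  qed (use pos i in auto)
qed

subsection \<open>Descent and \<open>r\<close>-bases\<close>

text \<open>By the linear independence just shown, the derivatives of the generators of \<open>stage m\<close> with respect to \<open>proot m x\<close> are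
  linearly independent over \<open>stage m\<close>, so the general facts on constants apply. The second
  statement is the descent step: an element of \<open>stage m\<close> whose \<open>p ^ n\<close>-th power lies in \<open>k\<close> is a
  constant when \<open>n < m\<close>.\<close>

lemma stage_step:
  assumes m: "m \<ge> 1"
  shows "\<And>i. i < m \<Longrightarrow> gen m i \<notin> adjoin (stage (m - 1)) (gen m ` ({..<m} - {i}))"
    and "\<And>n u. n < m \<Longrightarrow> u \<in> stage m \<Longrightarrow> u ^ CHAR('a) ^ n \<in> k \<Longrightarrow> u \<in> stage (m - 1)"
proof -
  obtain M D where D: "derivation_on M D" and M: "subfield M ambient"
    and const: "stage (m - 1) \<subseteq> {a \<in> M. D a = 0}" and gens: "gen m ` {..<m} \<subseteq> M"
    and D0: "D (gen m 0) = 1"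
    and Dj: "\<And>j. 1 \<le> j \<Longrightarrow> j < m \<Longrightarrow> D (gen m j) = proot (m - j) (z j)"
    and roots: "\<And>n u. n < m \<Longrightarrow> u ^ CHAR('a) ^ n \<in> k \<Longrightarrow> D u = 0"
    using derivation_x[OF m] by blast
  have gen: "adjoin (stage (m - 1)) (gen m ` {..<m}) = stage m"
    by (rule stage_gen[OF m stage_mono stage_base]) simp
  have ind: "c i = 0" if "\<And>j. j < m \<Longrightarrow> c j \<in> adjoin (stage (m - 1)) (gen m ` {..<m})"
    "(\<Sum>j<m. c j * D (gen m j)) = 0" "i < m" for c i
  proof (rule roots_z_independent[of m c])
    show "c j \<in> stage m" if "j < m" for j using \<open>\<And>j. j < m \<Longrightarrow> c j \<in> _\<close>[OF that] gen by simp
    have "{..<m} = insert 0 {1..<m}" using m by auto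
    then have "(\<Sum>j<m. c j * D (gen m j)) = c 0 + (\<Sum>j\<in>{1..<m}. c j * D (gen m j))"
      using D0 by simp
    also have "(\<Sum>j\<in>{1..<m}. c j * D (gen m j)) = (\<Sum>j\<in>{1..<m}. c j * proot (m - j) (z j))"
      by (rule sum.cong[OF refl]) (simp add: Dj)
    finally show "c 0 + (\<Sum>j\<in>{1..<m}. c j * proot (m - j) (z j)) = 0"
      using that(2) by simp
  qed (rule that)
  show "gen m i \<notin> adjoin (stage (m - 1)) (gen m ` ({..<m} - {i}))" if "i < m" for i
  proof (rule derivation_p_independent[OF char D M stage_subfield const gens gen_frob _ that])
    fix c j assume "\<And>j. j < m \<Longrightarrow> c j \<in> adjoin (stage (m - 1)) (gen m ` {..<m})"
      "(\<Sum>j<m. c j * D (gen m j)) = 0" "j < m"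
    then show "c j = 0" by (rule ind)
  qed
  show "u \<in> stage (m - 1)" if "n < m" "u \<in> stage m" "u ^ CHAR('a) ^ n \<in> k" for n u
  proof (rule derivation_constants[OF char D M stage_subfield const gens gen_frob _ order_refl])
    show "u \<in> adjoin (stage (m - 1)) (gen m ` {..<m})" unfolding gen by (rule that(2))
    show "D u = 0" by (rule roots[OF that(1,3)])
    fix c j assume "\<And>j. j < m \<Longrightarrow> c j \<in> adjoin (stage (m - 1)) (gen m ` {..<m})"
      "(\<Sum>j<m. c j * D (gen m j)) = 0" "j < m"
    then show "c j = 0" by (rule ind)
  qed
qed

lemma descent:
  assumes "u \<in> stage m" "u ^ CHAR('a) ^ n \<in> k"
  shows "u \<in> stage n"
proof (cases "m \<le> n")
  case True
  then show ?thesis using stage_mono assms(1) by blast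
next
  case False
  then have "n \<le> m" by simp
  then show ?thesis using assms(1)
  proof (induction m rule: dec_induct)
    case (step m)
    then show ?case using stage_step(2)[of "Suc m" n u] assms(2) by simp
  qed
qed

lemma ext_field_stages: "ext_field Q x y z = (\<Union>m. stage m)"
proof -
  have "stage m \<subseteq> stage (max m 2)" for m by (rule stage_mono) simp
  moreover have "max m 2 \<in> {2..}" for m :: nat by simp
  ultimately show ?thesis unfolding ext_field_def by blast
qed

text \<open>Descent gives one inclusion, the exponent of \<open>stage n\<close> over \<open>k\<close> the other. Finiteness of the
  layers and the growth of their \<open>r\<close>-bases can now be read off from the generators of \<open>stage n\<close>.\<close>

lemma root_layer_eq_stage: "root_layer k (ext_field Q x y z) n = stage n"
  unfolding root_layer_def ext_field_stages using descent stage_exponent by blast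

lemma ext_field_subfield: "subfield (ext_field Q x y z) ambient"
  unfolding ext_field_stages
proof (rule subfieldI_ambient)
  show "1 \<in> (\<Union>m. stage m)" using subfield_1[OF stage_subfield] by blast
next
  fix a b assume "a \<in> (\<Union>m. stage m)" "b \<in> (\<Union>m. stage m)"
  then obtain i j where "a \<in> stage i" "b \<in> stage j" by blast
  then have ab: "a \<in> stage (max i j)" "b \<in> stage (max i j)"
    using stage_mono[of i "max i j"] stage_mono[of j "max i j"] by auto
  show "a + b \<in> (\<Union>m. stage m)" using subfield_add[OF stage_subfield ab] by blast
  show "a * b \<in> (\<Union>m. stage m)" using subfield_mult[OF stage_subfield ab] by blast
next
  fix a assume "a \<in> (\<Union>m. stage m)"
  then obtain i where a: "a \<in> stage i" by blast
  show "- a \<in> (\<Union>m. stage m)" using subfield_uminus[OF stage_subfield a] by blast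
  show "inverse a \<in> (\<Union>m. stage m)" using subfield_inverse[OF stage_subfield a] by blast
qed

lemma ext_field_lq_finite: "lq_finite k (ext_field Q x y z)"
proof -
  have "k \<subseteq> ext_field Q x y z" unfolding ext_field_stages using stage_base by blast
  then have "purely_inseparable k (ext_field Q x y z)"
    unfolding purely_inseparable_def
    using base_field_subfield ext_field_subfield stage_exponent by (auto simp: ext_field_stages)
  moreover have "ring.finite_dimension ambient k (stage n)" for n
    unfolding ext_stage_def by (rule finite_dimension_adjoin[OF closure]) simp
  ultimately show ?thesis unfolding lq_finite_def root_layer_eq_stage by blast
qed

text \<open>The \<open>p\<close>-th powers of \<open>stage n\<close> lie in \<open>stage (n - 1)\<close>, over which the \<open>n\<close> generators are
  independent.\<close>

lemma stage_r_base:
  assumes n: "n \<ge> 1"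
  shows "r_base k (stage n) (gen n ` {..<n})" and "inj_on (gen n) {..<n}"
proof -
  define F where "F = adjoin k ((\<lambda>u. u ^ CHAR('a)) ` stage n)"
  have notin: "gen n i \<notin> adjoin (stage (n - 1)) (gen n ` ({..<n} - {i}))" if "i < n" for i
    by (rule stage_step(1)[OF n that])
  have "stage n \<subseteq> {u. u ^ CHAR('a) ^ 1 \<in> stage (n - 1)}"
    unfolding stage_gen[OF n stage_base order_refl, symmetric]
  proof (rule adjoin_least[OF subfield_frob_preimage[OF char stage_subfield]])
    show "k \<subseteq> {u. u ^ CHAR('a) ^ 1 \<in> stage (n - 1)}"
      using stage_base subfield_power[OF stage_subfield] by blast
    show "gen n ` {..<n} \<subseteq> {u. u ^ CHAR('a) ^ 1 \<in> stage (n - 1)}" using gen_frob by auto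
  qed
  then have F: "F \<subseteq> stage (n - 1)"
    unfolding F_def by (intro adjoin_least stage_subfield stage_base) auto
  have "k \<subseteq> F" unfolding F_def by (rule adjoin_base)
  moreover have "F \<subseteq> stage n" using F stage_mono[of "n - 1" n] by simp
  ultimately have gen: "adjoin F (gen n ` {..<n}) = stage n" by (intro stage_gen[OF n])
  have min: "gen n i \<notin> adjoin F (gen n ` {..<n} - {gen n i})" if "i < n" for i
  proof -
    have "adjoin F (gen n ` {..<n} - {gen n i}) \<subseteq> adjoin (stage (n - 1)) (gen n ` ({..<n} - {i}))"
      using F by (intro adjoin_mono) auto
    then show ?thesis using notin[OF that] by blast
  qed
  show "r_base k (stage n) (gen n ` {..<n})"
    unfolding r_base_def Let_def F_def[symmetric] using gen min gen_stage by auto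
  show "inj_on (gen n) {..<n}"
  proof (rule inj_onI, rule ccontr)
    fix i j assume ij: "i \<in> {..<n}" "j \<in> {..<n}" "gen n i = gen n j" "i \<noteq> j"
    then have "gen n i \<in> gen n ` ({..<n} - {i})" by auto
    then show False using notin[of i] ij(1) by (auto intro: adjoin_generatorI)
  qed
qed

lemma irrationality_degree_infinite: "cinfinite (irrationality_degree k (ext_field Q x y z))"
proof -
  let ?c = "irrationality_degree k (ext_field Q x y z)"
  have c: "Card_order ?c" unfolding irrationality_degree_def by (rule card_Sup(1))
  have "infinite (Field ?c)"
  proof
    assume fin: "finite (Field ?c)"
    define n where "n = Suc (card (Field ?c))"
    let ?B = "gen n ` {..<n}"
    have "|?B| \<le>o ?c"
      unfolding irrationality_degree_def root_layer_eq_stage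
      by (rule card_Sup(2)) (use stage_r_base(1)[of n] in \<open>auto simp: n_def\<close>)
    then have "|?B| \<le>o |Field ?c|"
      using ordLeq_ordIso_trans ordIso_symmetric[OF card_of_Field_ordIso[OF c]] by blast
    then obtain f where "inj_on f ?B" "f ` ?B \<subseteq> Field ?c"
      using card_of_ordLeq[of ?B "Field ?c"] by blast
    then have "card ?B \<le> card (Field ?c)" using fin by (rule card_inj_on_le)
    moreover have "card ?B = n" using stage_r_base(2)[of n] by (simp add: card_image n_def)
    ultimately show False by (simp add: n_def)
  qed
  then show ?thesis using c by (simp add: cinfinite_def)
qed

end

theorem mainTheorem14:
  fixes Q :: "'a::field set" and x :: 'a and y z :: "nat \<Rightarrow> 'a"
  defines "k \<equiv> base_field Q x y z"
  defines "K \<equiv> ext_field Q x y z"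
  assumes "CHAR('a) > 0"
    and "perfect_subfield Q"
    and "alg_independent Q indets (indet_val x y z)"
    and "algebraic_closure ring_of_type_algebra k"
  shows "lq_finite k K \<and> cinfinite (irrationality_degree k K)"
proof -
  have "subfield Q ambient" using assms(4) by (simp add: perfect_subfield_def)
  from inseparable_tower.intro[OF assms(3) this assms(5) assms(6)[unfolded k_def]]
  have "inseparable_tower Q x y z" .
  then show ?thesis
    unfolding k_def K_def
    by (intro conjI inseparable_tower.ext_field_lq_finite
        inseparable_tower.irrationality_degree_infinite)
qed

end
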